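(* We have \[1.62924<\lim_{n\to\infty}\deg(s:S_n\to S_n)^{1/n}.\]
   Context: $S_n$ is the set of permutations of $\{1,\dots,n\}$ written in one-line notation. West's stack-sorting map $s$ is defined recursively on permutations of finite sets of positive integers: $s$ of the empty permutation is empty, and if $\pi=LmR$ with $m$ the largest entry of $\pi$, then $s(\pi)=s(L)\,s(R)\,m$; it maps $S_n$ to $S_n$. For a finite set $X$ and a function $f:X\to X$, the degree of noninvertibility of $f$ is $\deg(f:X\to X)=\frac{1}{|X|}\sum_{x\in X}|f^{-1}(x)|^2$. It is known (Defant–Propp) that the limit $\lim_{n\to\infty}\deg(s:S_n\to S_n)^{1/n}$ exists. *)

theory Defs
  imports Complex_Main "HOL-Combinatorics.Multiset_Permutations"
begin

text \<open>
  Permutations in one-line notation are distinct lists, so that \<open>S\<^sub>n\<close> is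
  \<open>permutations_of_set {1..n}\<close>.  West's map is a total function on lists; on lists with
  repeated entries, which are never used, it splits at the first occurrence of the maximum.
\<close>

function stack_sort :: "nat list \<Rightarrow> nat list" where
  "stack_sort [] = []"
| "stack_sort (x # xs) =
     (let \<pi> = x # xs;
          m = Max (set \<pi>);
          L = takeWhile (\<lambda>y. y \<noteq> m) \<pi>;
          R = tl (dropWhile (\<lambda>y. y \<noteq> m) \<pi>)
      in stack_sort L @ stack_sort R @ [m])"
  by pat_completeness auto
termination
proof (relation "measure length", goal_cases)
  case (2 x xs \<pi> m L)
  have "m \<in> set \<pi>"
    unfolding 2 by (rule Max_in) auto
  hence "dropWhile (\<lambda>y. y \<noteq> m) \<pi> \<noteq> []"
    by (auto simp: dropWhile_eq_Nil_conv)
  moreover have "length \<pi> = length L + length (dropWhile (\<lambda>y. y \<noteq> m) \<pi>)"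
    unfolding 2 by (metis length_append takeWhile_dropWhile_id)
  ultimately show ?case
    by (simp add: 2)
next
  case (3 x xs \<pi> m L R)
  show ?case
    using length_dropWhile_le[of "\<lambda>y. y \<noteq> m" \<pi>] by (simp add: 3)
qed auto

lemma stack_sort_split:
  assumes "\<forall>y \<in> set L \<union> set R. y < m"
  shows "stack_sort (L @ m # R) = stack_sort L @ stack_sort R @ [m]"
proof -
  have M: "Max (set (L @ m # R)) = m"
    using assms by (intro Max_eqI) (auto simp: less_imp_le)
  have ne: "\<forall>y \<in> set L. y \<noteq> m"
    using assms by auto
  have tw: "takeWhile (\<lambda>y. y \<noteq> m) (L @ m # R) = L"
    using ne by (simp add: takeWhile_append2)
  have dw: "dropWhile (\<lambda>y. y \<noteq> m) (L @ m # R) = m # R"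
    using ne by (simp add: dropWhile_append2)
  obtain x xs where x: "L @ m # R = x # xs"
    by (cases "L @ m # R") auto
  show ?thesis
    using M tw dw unfolding x by (simp add: Let_def)
qed

lemma mset_stack_sort: "mset (stack_sort \<pi>) = mset \<pi>"
proof (induction \<pi> rule: length_induct)
  case (1 \<pi>)
  show ?case
  proof (cases \<pi>)
    case (Cons x xs)
    define m where "m = Max (set \<pi>)"
    define L where "L = takeWhile (\<lambda>y. y \<noteq> m) \<pi>"
    define R where "R = tl (dropWhile (\<lambda>y. y \<noteq> m) \<pi>)"
    have "m \<in> set \<pi>"
      unfolding m_def using Cons by (intro Max_in) auto
    hence "dropWhile (\<lambda>y. y \<noteq> m) \<pi> \<noteq> []"
      by (auto simp: dropWhile_eq_Nil_conv)
    hence "dropWhile (\<lambda>y. y \<noteq> m) \<pi> = m # R"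
      unfolding R_def by (metis (mono_tags, lifting) hd_Cons_tl hd_dropWhile)
    hence split: "\<pi> = L @ m # R"
      unfolding L_def by (metis takeWhile_dropWhile_id)
    have "stack_sort \<pi> = stack_sort L @ stack_sort R @ [m]"
      unfolding L_def R_def m_def Cons by (simp add: Let_def)
    moreover have "mset (stack_sort L) = mset L" "mset (stack_sort R) = mset R"
      using 1 split by auto
    ultimately show ?thesis
      by (simp add: split)
  qed auto
qed

lemma stack_sort_permutations:
  "stack_sort \<in> permutations_of_set {1..n} \<rightarrow> permutations_of_set {1..n}"
proof
  fix \<pi> assume "\<pi> \<in> permutations_of_set {1..n}"
  thus "stack_sort \<pi> \<in> permutations_of_set {1..n}"
    using mset_stack_sort[of \<pi>] mset_eq_imp_distinct_iff mset_eq_setD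
    unfolding permutations_of_set_def by blast
qed

text \<open>
  The degree of noninvertibility of \<open>f : X \<rightarrow> X\<close>, meaningful for finite \<open>X\<close> and \<open>f\<close> mapping
  \<open>X\<close> to itself; preimages are taken within \<open>X\<close>.
\<close>

definition deg_noninv :: "'a set \<Rightarrow> ('a \<Rightarrow> 'a) \<Rightarrow> real" where
  "deg_noninv X f = 1 / real (card X) * (\<Sum>x\<in>X. (real (card (f -` {x} \<inter> X)))\<^sup>2)"

end

theory Submission
  imports Defs "HOL-Library.Infinite_Set" "HOL-Real_Asymp.Real_Asymp"
begin

text \<open>
  Let \<open>f \<sigma>\<close> be the number of preimages of \<open>\<sigma>\<close> under stack-sorting (\<open>fert\<close>). The degree of \<open>s\<close> on
  \<open>S\<^sub>n\<close> is the mean \<open>b\<^sub>n\<close> of \<open>f\<^sup>2\<close> over \<open>S\<^sub>n\<close> (\<open>degree_mean\<close>). If \<open>m\<close> exceeds all entries of \<open>\<tau>\<close>, the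
  preimages of \<open>\<tau> m\<close> are the words \<open>L m R\<close> with \<open>s(L) s(R) = \<tau>\<close>, so \<open>f(\<tau> m)\<close> is the sum of
  \<open>f(\<alpha>) f(\<gamma>)\<close> over all cuts \<open>\<tau> = \<alpha> \<gamma>\<close>, and \<open>f\<close> vanishes on words that do not end in their
  maximum (\<open>fert_snoc\<close>, \<open>fert_snoc_nonzero\<close>). Means over \<open>S\<^sub>n\<close> turn sums over cuts into Cauchy products
  and the removal of the maximum into a derivative (\<open>perm_mean_cut_conv\<close>, \<open>perm_mean_Suc\<close>). Inequalities
  between statistics of a single word thus become differential inequalities between generating
  functions.

  Keeping only equal cuts in \<open>f(\<tau> m)\<^sup>2\<close> gives \<open>B' \<ge> B\<^sup>2\<close> for \<open>B(x) = \<Sum> b\<^sub>n x\<^sup>n\<close>, which shows only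
  that the growth rate is at least \<open>1\<close>. Pairs of different cuts, one of them trivial, give in addition
  \<open>2 (B - 1) + 4 E\<close>, where \<open>E\<close> belongs to the statistic \<open>f(\<tau>) \<Sum> f(\<alpha>) f(\<gamma>)\<close> over proper cuts (\<open>overlap\<close>);
  and a similar selection of cuts yields \<open>E' \<ge> (B - 1) (2 B + E) + 4 E\<close>. See \<open>degree_mean_Suc\<close> and
  \<open>overlap_mean_Suc\<close>.

  These recurrences bound finitely many \<open>b\<^sub>n\<close> from below, well enough that the partial sum of \<open>B\<close> at
  \<open>0.59\<close> exceeds \<open>1 / (1 / 1.62924 - 0.59)\<close>. From there on, \<open>B' \<ge> B\<^sup>2\<close> alone forces \<open>B\<close> to blow up before
  \<open>1 / 1.62924\<close> (\<open>riccati_radius_bound\<close>), so the growth rate of \<open>b\<^sub>n\<close> is larger than \<open>1.62924\<close>.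

  The limit exists because \<open>b\<^sub>i b\<^sub>j \<le> (i + j + 1) b\<^bsub>i+j+1\<^esub>\<close>, a supermultiplicativity with a factor that is
  harmless as long as words are split into balanced halves (\<open>balanced_fekete\<close>), and because
  \<open>f\<close> is bounded by Catalan numbers.
\<close>

section \<open>Means of order-invariant statistics of permutations\<close>

definition perm_sum :: "(nat list \<Rightarrow> real) \<Rightarrow> nat set \<Rightarrow> real" where
  "perm_sum \<phi> A = (\<Sum>\<sigma>\<in>permutations_of_set A. \<phi> \<sigma>)"

definition perm_mean :: "(nat list \<Rightarrow> real) \<Rightarrow> nat \<Rightarrow> real" where
  "perm_mean \<phi> n = perm_sum \<phi> {..<n} / fact n"

text \<open>
  Statistics of this kind depend only on the relative order of the entries, so that their sum over
  the permutations of a finite set depends only on the size of that set.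
\<close>
definition pattern_invariant :: "(nat list \<Rightarrow> real) \<Rightarrow> bool" where
  "pattern_invariant \<phi> \<longleftrightarrow>
     (\<forall>\<sigma> g. distinct \<sigma> \<longrightarrow> strict_mono_on (set \<sigma>) g \<longrightarrow> \<phi> (map g \<sigma>) = \<phi> \<sigma>)"

text \<open>
  The convolution over all ways of cutting a word into a prefix and a suffix, that is, the product
  dual to deconcatenation. It is chosen because passing to means turns it into the Cauchy product.
\<close>
definition cut_conv ::
    "(nat list \<Rightarrow> real) \<Rightarrow> (nat list \<Rightarrow> real) \<Rightarrow> nat list \<Rightarrow> real" (infixl \<open>\<star>\<close> 70) where
  "(\<phi> \<star> \<psi>) \<sigma> = (\<Sum>i\<le>length \<sigma>. \<phi> (take i \<sigma>) * \<psi> (drop i \<sigma>))"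

lemma pattern_invariantD:
  "pattern_invariant \<phi> \<Longrightarrow> distinct \<sigma> \<Longrightarrow> strict_mono_on (set \<sigma>) g \<Longrightarrow> \<phi> (map g \<sigma>) = \<phi> \<sigma>"
  by (simp add: pattern_invariant_def)

lemma pattern_invariant_mult:
  "pattern_invariant \<phi> \<Longrightarrow> pattern_invariant \<psi> \<Longrightarrow> pattern_invariant (\<lambda>\<sigma>. \<phi> \<sigma> * \<psi> \<sigma>)"
  by (simp add: pattern_invariant_def)

lemma pattern_invariant_cut_conv:
  assumes "pattern_invariant \<phi>" "pattern_invariant \<psi>"
  shows "pattern_invariant (\<phi> \<star> \<psi>)"
  unfolding pattern_invariant_def
proof (intro allI impI)
  fix \<sigma> :: "nat list" and g :: "nat \<Rightarrow> nat"
  assume d: "distinct \<sigma>" and g: "strict_mono_on (set \<sigma>) g"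
  have "\<phi> (take i (map g \<sigma>)) = \<phi> (take i \<sigma>)" for i
    unfolding take_map
    by (rule pattern_invariantD[OF assms(1)])
       (use d g in \<open>simp_all add: monotone_on_subset[OF _ set_take_subset]\<close>)
  moreover have "\<psi> (drop i (map g \<sigma>)) = \<psi> (drop i \<sigma>)" for i
    unfolding drop_map
    by (rule pattern_invariantD[OF assms(2)])
       (use d g in \<open>simp_all add: monotone_on_subset[OF _ set_drop_subset]\<close>)
  ultimately show "(\<phi> \<star> \<psi>) (map g \<sigma>) = (\<phi> \<star> \<psi>) \<sigma>"
    by (simp add: cut_conv_def)
qed

lemma perm_sum_eq_perm_mean:
  assumes "pattern_invariant \<phi>" and fin: "finite A"
  shows "perm_sum \<phi> A = fact (card A) * perm_mean \<phi> (card A)"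
proof -
  obtain g where bij: "bij_betw g {..<card A} A" and mono: "strict_mono_on {..<card A} g"
    using ex_bij_betw_strict_mono_card[OF fin] by blast
  have img: "permutations_of_set A = map g ` permutations_of_set {..<card A}"
    using permutations_of_set_image_inj[of g "{..<card A}"] bij by (simp add: bij_betw_def)
  have inj: "inj_on (map g) (permutations_of_set {..<card A})"
  proof (rule inj_onI)
    fix xs ys assume "xs \<in> permutations_of_set {..<card A}" "ys \<in> permutations_of_set {..<card A}"
      "map g xs = map g ys"
    moreover have "inj_on g {..<card A}" using bij by (simp add: bij_betw_def)
    moreover have "set xs \<union> set ys = {..<card A}"
      using calculation by (simp add: permutations_of_set_def)
    ultimately show "xs = ys"
      by (metis map_inj_on)
  qed
  have "perm_sum \<phi> A = (\<Sum>\<sigma>\<in>permutations_of_set {..<card A}. \<phi> (map g \<sigma>))"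
    unfolding perm_sum_def img by (rule sum.reindex[OF inj, unfolded comp_def])
  also have "\<dots> = perm_sum \<phi> {..<card A}"
    unfolding perm_sum_def
    by (intro sum.cong refl pattern_invariantD[OF assms(1)])
       (use mono in \<open>auto simp: permutations_of_set_def\<close>)
  finally show ?thesis by (simp add: perm_mean_def)
qed

lemma sum_Pow_card:
  fixes g :: "nat \<Rightarrow> real"
  assumes "finite A"
  shows "(\<Sum>S\<in>Pow A. g (card S)) = (\<Sum>k\<le>card A. real (card A choose k) * g k)"
proof -
  have "(\<Sum>S\<in>Pow A. g (card S)) = (\<Sum>k\<le>card A. \<Sum>S | S \<in> Pow A \<and> card S = k. g (card S))"
    using assms by (intro sum.group[symmetric]) (auto intro: card_mono)
  also have "\<dots> = (\<Sum>k\<le>card A. real (card A choose k) * g k)"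
    using n_subsets[OF assms] by (intro sum.cong refl) simp
  finally show ?thesis .
qed

text \<open>
  A permutation together with a cut is the same as a subset \<open>S\<close> with one permutation of \<open>S\<close> and one
  of its complement.
\<close>
lemma perm_sum_cut_conv:
  assumes fin: "finite A"
  shows "perm_sum (\<phi> \<star> \<psi>) A = (\<Sum>S\<in>Pow A. perm_sum \<phi> S * perm_sum \<psi> (A - S))"
proof -
  let ?I = "SIGMA \<sigma>:permutations_of_set A. {..length \<sigma>}"
  let ?J = "SIGMA S:Pow A. permutations_of_set S \<times> permutations_of_set (A - S)"
  have "perm_sum (\<phi> \<star> \<psi>) A = (\<Sum>(\<sigma>, i)\<in>?I. \<phi> (take i \<sigma>) * \<psi> (drop i \<sigma>))"
    unfolding perm_sum_def cut_conv_def by (subst sum.Sigma) auto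
  also have "\<dots> = (\<Sum>(S, \<alpha>, \<beta>)\<in>?J. \<phi> \<alpha> * \<psi> \<beta>)"
  proof (rule sum.reindex_bij_witness[where
        i = "\<lambda>(S, \<alpha>, \<beta>). (\<alpha> @ \<beta>, length \<alpha>)" and
        j = "\<lambda>(\<sigma>, i). (set (take i \<sigma>), take i \<sigma>, drop i \<sigma>)"])
    fix p assume "p \<in> ?I"
    then obtain \<sigma> i where p: "p = (\<sigma>, i)" "set \<sigma> = A" "distinct \<sigma>" "i \<le> length \<sigma>"
      by (auto simp: permutations_of_set_def)
    have "set (take i \<sigma>) \<union> set (drop i \<sigma>) = A"
      using p(2) by (metis append_take_drop_id set_append)
    moreover have "set (take i \<sigma>) \<inter> set (drop i \<sigma>) = {}"
      using p(3) by (simp add: set_take_disj_set_drop_if_distinct)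
    ultimately have "A - set (take i \<sigma>) = set (drop i \<sigma>)" "set (take i \<sigma>) \<subseteq> A" by auto
    thus "(case p of (\<sigma>, i) \<Rightarrow> (set (take i \<sigma>), take i \<sigma>, drop i \<sigma>)) \<in> ?J"
      using p by (simp add: permutations_of_set_def)
  qed (auto simp: permutations_of_set_def)
  also have "\<dots> = (\<Sum>S\<in>Pow A. \<Sum>\<alpha>\<in>permutations_of_set S.
                     \<Sum>\<beta>\<in>permutations_of_set (A - S). \<phi> \<alpha> * \<psi> \<beta>)"
    using fin by (simp add: sum.Sigma sum.cartesian_product)
  finally show ?thesis
    by (simp add: perm_sum_def sum_product)
qed

text \<open>
  The binomial coefficient that counts the subsets of size \<open>k\<close> is absorbed by the factorials in the
  means: the ordinary generating function of the means is an exponential generating function of the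
  sums.
\<close>
lemma perm_mean_cut_conv:
  assumes "pattern_invariant \<phi>" "pattern_invariant \<psi>"
  shows "perm_mean (\<phi> \<star> \<psi>) n = (\<Sum>k\<le>n. perm_mean \<phi> k * perm_mean \<psi> (n - k))"
proof -
  let ?g = "\<lambda>k. (fact k * perm_mean \<phi> k) * (fact (n - k) * perm_mean \<psi> (n - k))"
  have "perm_sum (\<phi> \<star> \<psi>) {..<n} = (\<Sum>S\<in>Pow {..<n}. ?g (card S))"
    unfolding perm_sum_cut_conv[OF finite_lessThan]
  proof (rule sum.cong[OF refl])
    fix S assume "S \<in> Pow {..<n}"
    hence "S \<subseteq> {..<n}" "finite S" by (auto intro: finite_subset)
    thus "perm_sum \<phi> S * perm_sum \<psi> ({..<n} - S) = ?g (card S)"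
      by (simp add: perm_sum_eq_perm_mean assms card_Diff_subset)
  qed
  also have "\<dots> = (\<Sum>k\<le>n. real (n choose k) * ?g k)"
    using sum_Pow_card[of "{..<n}" ?g] by simp
  also have "\<dots> = (\<Sum>k\<le>n. fact n * (perm_mean \<phi> k * perm_mean \<psi> (n - k)))"
    by (intro sum.cong refl) (simp add: binomial_fact field_simps)
  also have "\<dots> = fact n * (\<Sum>k\<le>n. perm_mean \<phi> k * perm_mean \<psi> (n - k))"
    by (rule sum_distrib_left[symmetric])
  finally show ?thesis
    unfolding perm_mean_def[of "\<phi> \<star> \<psi>"] by simp
qed

lemma permutations_of_set_snoc:
  "(\<lambda>\<tau>. \<tau> @ [n]) ` permutations_of_set {..<n} =
   {\<sigma> \<in> permutations_of_set {..<Suc n}. \<sigma> \<noteq> [] \<and> last \<sigma> = n}" (is "?L = ?R")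
proof
  show "?L \<subseteq> ?R"
  proof
    fix \<sigma> assume "\<sigma> \<in> ?L"
    then obtain \<tau> where "\<sigma> = \<tau> @ [n]" "set \<tau> = {..<n}" "distinct \<tau>"
      unfolding permutations_of_set_def by blast
    thus "\<sigma> \<in> ?R" by (simp add: permutations_of_set_def lessThan_Suc)
  qed
  show "?R \<subseteq> ?L"
  proof
    fix \<sigma> assume \<sigma>: "\<sigma> \<in> ?R"
    then obtain \<tau> where \<tau>: "\<sigma> = \<tau> @ [n]" by (cases \<sigma> rule: rev_cases) auto
    with \<sigma> have "insert n (set \<tau>) = {..<Suc n}" "distinct \<tau>" "n \<notin> set \<tau>"
      by (auto simp: permutations_of_set_def)
    hence "set \<tau> = {..<n}" by (auto simp: set_eq_iff less_Suc_eq)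
    with \<tau> \<open>distinct \<tau>\<close> show "\<sigma> \<in> ?L" by (auto simp: permutations_of_set_def)
  qed
qed

text \<open>
  A statistic that vanishes off the permutations ending in their maximum lives on \<open>n!\<close> of the
  \<open>(n + 1)!\<close> permutations. In terms of generating functions, removing the maximum is differentiation;
  the factor \<open>Suc n\<close> is the one produced by the derivative of \<open>x ^ Suc n\<close>.
\<close>
lemma perm_mean_Suc:
  assumes vanish: "\<And>\<tau> m. distinct (\<tau> @ [m]) \<Longrightarrow> \<phi> (\<tau> @ [m]) \<noteq> 0 \<Longrightarrow> \<forall>y\<in>set \<tau>. y < m"
    and step: "\<And>\<tau> m. distinct \<tau> \<Longrightarrow> \<forall>y\<in>set \<tau>. y < m \<Longrightarrow> \<psi> \<tau> \<le> \<phi> (\<tau> @ [m])"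
  shows "perm_mean \<psi> n \<le> real (Suc n) * perm_mean \<phi> (Suc n)"
proof -
  let ?R = "{\<sigma> \<in> permutations_of_set {..<Suc n}. \<sigma> \<noteq> [] \<and> last \<sigma> = n}"
  have "perm_sum \<psi> {..<n} \<le> (\<Sum>\<tau>\<in>permutations_of_set {..<n}. \<phi> (\<tau> @ [n]))"
    unfolding perm_sum_def by (intro sum_mono step) (auto simp: permutations_of_set_def)
  also have "\<dots> = (\<Sum>\<sigma>\<in>?R. \<phi> \<sigma>)"
    unfolding permutations_of_set_snoc[symmetric] by (subst sum.reindex) (auto simp: inj_on_def)
  also have "\<dots> = perm_sum \<phi> {..<Suc n}"
    unfolding perm_sum_def
  proof (rule sum.mono_neutral_left)
    show "\<forall>\<sigma>\<in>permutations_of_set {..<Suc n} - ?R. \<phi> \<sigma> = 0"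
    proof (rule ballI, rule ccontr)
      fix \<sigma> assume \<sigma>: "\<sigma> \<in> permutations_of_set {..<Suc n} - ?R" and nz: "\<phi> \<sigma> \<noteq> 0"
      have s: "set \<sigma> = {..<Suc n}" "distinct \<sigma>"
        using \<sigma> by (simp_all add: permutations_of_set_def)
      have n: "n \<in> set \<sigma>" unfolding s by simp
      then obtain \<tau> m where \<tau>: "\<sigma> = \<tau> @ [m]" by (cases \<sigma> rule: rev_cases) simp_all
      have "m \<in> {..<Suc n}" unfolding s(1)[symmetric] \<tau> by simp
      moreover have "\<forall>y\<in>set \<tau>. y < m" using vanish[of \<tau> m] nz s(2) \<tau> by simp
      moreover have "m \<noteq> n" using \<sigma> \<tau> by simp
      ultimately show False using \<tau> n by auto
    qed
  qed auto
  finally show ?thesis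
    by (simp add: perm_mean_def divide_simps)
qed

lemma perm_mean_add: "perm_mean (\<lambda>\<sigma>. \<phi> \<sigma> + \<psi> \<sigma>) n = perm_mean \<phi> n + perm_mean \<psi> n"
  by (simp add: perm_mean_def perm_sum_def sum.distrib add_divide_distrib)

lemma perm_mean_cmult: "perm_mean (\<lambda>\<sigma>. c * \<phi> \<sigma>) n = c * perm_mean \<phi> n"
  unfolding perm_mean_def perm_sum_def sum_distrib_left[symmetric] by simp

section \<open>Fertility of a word\<close>

definition fert :: "nat list \<Rightarrow> real" where
  "fert \<sigma> = real (card {\<pi>. stack_sort \<pi> = \<sigma>})"

text \<open>
  Removing the empty word makes \<open>fert1 \<star> fert1\<close> the sum over the proper cuts alone.
\<close>
definition fert1 :: "nat list \<Rightarrow> real" where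
  "fert1 \<sigma> = (if \<sigma> = [] then 0 else fert \<sigma>)"

lemma fert_nonneg [simp]: "0 \<le> fert \<sigma>" and fert1_nonneg [simp]: "0 \<le> fert1 \<sigma>"
  by (simp_all add: fert_def fert1_def)

lemma finite_fiber: "finite {\<pi>. stack_sort \<pi> = \<sigma>}"
proof (rule finite_subset)
  show "{\<pi>. stack_sort \<pi> = \<sigma>} \<subseteq> permutations_of_multiset (mset \<sigma>)"
    using mset_stack_sort by (auto simp: permutations_of_multiset_def)
qed simp

lemma stack_sort_eq_Nil_iff: "stack_sort \<pi> = [] \<longleftrightarrow> \<pi> = []"
  using mset_stack_sort[of \<pi>] by auto

lemma fert_Nil [simp]: "fert [] = 1"
  by (simp add: fert_def stack_sort_eq_Nil_iff)

lemma fert1_Nil [simp]: "fert1 [] = 0"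
  by (simp add: fert1_def)

lemma fert_snoc_nonzero:
  assumes "distinct (\<tau> @ [m])" "fert (\<tau> @ [m]) \<noteq> 0"
  shows "\<forall>y\<in>set \<tau>. y < m"
proof -
  have "{\<pi>. stack_sort \<pi> = \<tau> @ [m]} \<noteq> {}"
    using assms(2) unfolding fert_def by force
  then obtain \<pi> where \<pi>: "stack_sort \<pi> = \<tau> @ [m]" by blast
  then obtain x xs where x: "\<pi> = x # xs" by (cases \<pi>) auto
  have "last (stack_sort \<pi>) = Max (set \<pi>)"
    unfolding x by (simp only: stack_sort.simps Let_def last_appendR last.simps append_is_Nil_conv
        list.distinct simp_thms if_True)
  hence m: "m = Max (set \<pi>)" unfolding \<pi> by simp
  have "mset \<pi> = mset (\<tau> @ [m])"
    using mset_stack_sort[of \<pi>] \<pi> by simp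
  hence set: "set \<pi> = set (\<tau> @ [m])" by (rule mset_eq_setD)
  show ?thesis
  proof
    fix y assume y: "y \<in> set \<tau>"
    hence "y \<in> set \<pi>" by (simp add: set)
    hence "y \<le> m" unfolding m by (simp add: Max_ge)
    moreover have "y \<noteq> m" using y assms(1) by auto
    ultimately show "y < m" by simp
  qed
qed

text \<open>
  A preimage of \<open>\<tau> @ [m]\<close> is \<open>L @ m # R\<close>, where the images of \<open>L\<close> and \<open>R\<close> form a cut of \<open>\<tau>\<close>; the cut
  is recovered from the length of \<open>L\<close>.
\<close>
lemma fert_snoc:
  assumes "\<forall>y\<in>set \<tau>. y < m"
  shows "fert (\<tau> @ [m]) = (fert \<star> fert) \<tau>"
proof -
  let ?fib = "\<lambda>\<sigma>. {\<pi>. stack_sort \<pi> = \<sigma>}"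
  let ?I = "SIGMA i:{..length \<tau>}. ?fib (take i \<tau>) \<times> ?fib (drop i \<tau>)"
  let ?join = "\<lambda>(i, L, R). L @ m # R"
  have small: "set L \<union> set R = set \<tau>"
    if "stack_sort L = take i \<tau>" "stack_sort R = drop i \<tau>" for i L R
  proof -
    have "mset L + mset R = mset (take i \<tau> @ drop i \<tau>)"
      unfolding mset_append using that mset_stack_sort by metis
    hence "mset (L @ R) = mset \<tau>" by simp
    hence "set (L @ R) = set \<tau>" by (rule mset_eq_setD)
    thus ?thesis by simp
  qed
  have "bij_betw ?join ?I (?fib (\<tau> @ [m]))"
  proof (rule bij_betwI')
    fix p q assume pq: "p \<in> ?I" "q \<in> ?I"
    obtain i L R j L' R' where
      p: "p = (i, L, R)" "stack_sort L = take i \<tau>" "stack_sort R = drop i \<tau>" "i \<le> length \<tau>" and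
      q: "q = (j, L', R')" "stack_sort L' = take j \<tau>" "stack_sort R' = drop j \<tau>" "j \<le> length \<tau>"
      using pq by (cases p, cases q) simp
    have notin: "m \<notin> set L" "m \<notin> set R" "m \<notin> set L'" "m \<notin> set R'"
      using small[OF p(2,3)] small[OF q(2,3)] assms by (metis UnCI less_irrefl)+
    have len: "length L = i" "length L' = j"
      using p q mset_stack_sort[of L] mset_stack_sort[of L']
      by (metis length_take min.absorb2 size_mset)+
    show "(?join p = ?join q) = (p = q)"
    proof
      assume "?join p = ?join q"
      hence "L @ m # R = L' @ m # R'" by (simp add: p q)
      hence "L = L' \<and> R = R'" using notin by (simp add: append_Cons_eq_iff)
      thus "p = q" using len by (simp add: p(1) q(1))
    qed simp
  next
    fix p assume p': "p \<in> ?I"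
    obtain i L R where
      p: "p = (i, L, R)" "stack_sort L = take i \<tau>" "stack_sort R = drop i \<tau>"
      using p' by (cases p) simp
    have "\<forall>y\<in>set L \<union> set R. y < m" using small[OF p(2,3)] assms by simp
    thus "?join p \<in> ?fib (\<tau> @ [m])" by (simp add: p stack_sort_split)
  next
    fix \<pi> assume "\<pi> \<in> ?fib (\<tau> @ [m])"
    hence \<pi>: "stack_sort \<pi> = \<tau> @ [m]" by simp
    have ms: "mset \<pi> = mset (\<tau> @ [m])" using mset_stack_sort[of \<pi>] \<pi> by simp
    hence "set \<pi> = set (\<tau> @ [m])" by (rule mset_eq_setD)
    hence "m \<in> set \<pi>" by simp
    then obtain L R where LR: "\<pi> = L @ m # R" by (meson split_list)
    have "mset (L @ R) = mset \<tau>" using ms by (simp add: LR)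
    hence "set (L @ R) = set \<tau>" by (rule mset_eq_setD)
    hence s: "set L \<union> set R = set \<tau>" by simp
    hence "stack_sort \<pi> = stack_sort L @ stack_sort R @ [m]"
      unfolding LR using assms by (intro stack_sort_split) auto
    hence "\<tau> = stack_sort L @ stack_sort R" using \<pi> by simp
    hence "(length (stack_sort L), L, R) \<in> ?I" by simp
    moreover have "\<pi> = ?join (length (stack_sort L), L, R)" by (simp add: LR)
    ultimately show "\<exists>p\<in>?I. \<pi> = ?join p" by blast
  qed
  hence "card (?fib (\<tau> @ [m])) = card ?I" by (rule bij_betw_same_card[symmetric])
  also have "\<dots> = (\<Sum>i\<le>length \<tau>. card (?fib (take i \<tau>)) * card (?fib (drop i \<tau>)))"
    by (subst card_SigmaI) (auto simp: finite_fiber card_cartesian_product)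
  finally show ?thesis by (simp add: fert_def cut_conv_def)
qed

text \<open>
  Removing the last entry reduces the fertility of a word to that of shorter ones, and whether the
  last entry is the maximum is visible in the relative order.
\<close>
lemma pattern_invariant_fert: "pattern_invariant fert"
proof -
  have "fert (map g \<sigma>) = fert \<sigma>" if "distinct \<sigma>" "strict_mono_on (set \<sigma>) g" for \<sigma> g
    using that
  proof (induction "length \<sigma>" arbitrary: \<sigma> rule: less_induct)
    case less
    show ?case
    proof (cases \<sigma> rule: rev_cases)
      case (snoc \<tau> m)
      have inj: "inj_on g (set \<sigma>)" using less.prems(2) by (rule strict_mono_on_imp_inj_on)
      have lt: "g y < g m \<longleftrightarrow> y < m" if "y \<in> set \<tau>" for y
        using strict_mono_on_less[OF less.prems(2)] that by (simp add: snoc)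
      show ?thesis
      proof (cases "\<forall>y\<in>set \<tau>. y < m")
        case True
        have IH: "fert (map g \<rho>) = fert \<rho>" if "\<rho> = take i \<tau> \<or> \<rho> = drop i \<tau>" for \<rho> i
        proof (rule less.hyps)
          have sub: "set \<rho> \<subseteq> set \<sigma>"
            using that by (auto simp: snoc dest: in_set_takeD in_set_dropD)
          show "length \<rho> < length \<sigma>" "distinct \<rho>" using that less.prems(1) by (auto simp: snoc)
          show "strict_mono_on (set \<rho>) g" by (rule monotone_on_subset[OF less.prems(2) sub])
        qed
        have "fert (map g \<sigma>) = (fert \<star> fert) (map g \<tau>)"
          using True lt by (simp add: snoc fert_snoc)
        also have "\<dots> = (fert \<star> fert) \<tau>"
          using IH[OF disjI1, OF refl] IH[OF disjI2, OF refl]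
          by (simp add: cut_conv_def take_map drop_map)
        finally show ?thesis using True by (simp add: snoc fert_snoc)
      next
        case False
        have "distinct (map g \<sigma>)" using less.prems(1) inj by (simp add: distinct_map)
        hence "fert (map g \<sigma>) = 0"
          using fert_snoc_nonzero[of "map g \<tau>" "g m"] False lt by (auto simp: snoc)
        moreover have "fert \<sigma> = 0"
          using fert_snoc_nonzero[of \<tau> m] False less.prems(1) by (auto simp: snoc)
        ultimately show ?thesis by simp
      qed
    qed simp
  qed
  thus ?thesis by (simp add: pattern_invariant_def)
qed

lemma pattern_invariant_fert1: "pattern_invariant fert1"
  using pattern_invariant_fert by (simp add: pattern_invariant_def fert1_def)

section \<open>Quadratic inequalities for fertilities\<close>

text \<open>
  The mixed term in \<open>(fert (\<sigma> @ [m]))\<^sup>2\<close>: for \<open>m\<close> larger than all entries of \<open>\<sigma>\<close>, it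
  counts the pairs of preimages of \<open>\<sigma> @ [m]\<close> of which the first ends in \<open>m\<close> and the second has \<open>m\<close>
  in its interior.
\<close>
definition overlap :: "nat list \<Rightarrow> real" where
  "overlap \<sigma> = fert \<sigma> * (fert1 \<star> fert1) \<sigma>"

lemma cut_conv_nonneg:
  "(\<And>\<sigma>. 0 \<le> \<phi> \<sigma>) \<Longrightarrow> (\<And>\<sigma>. 0 \<le> \<psi> \<sigma>) \<Longrightarrow> 0 \<le> (\<phi> \<star> \<psi>) \<sigma>"
  by (simp add: cut_conv_def sum_nonneg)

lemma overlap_nonneg: "0 \<le> overlap \<sigma>"
  by (simp add: overlap_def cut_conv_nonneg)

lemma sum_split_ends:
  fixes g :: "nat \<Rightarrow> real"
  assumes "0 < n"
  shows "sum g {..n} = g 0 + sum g {0<..<n} + g n"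
proof -
  have "{..n} = insert 0 (insert n {0<..<n})" using assms by auto
  thus ?thesis using assms by simp
qed

lemma fert1_conv_eq_inner_sum:
  "(fert1 \<star> fert1) \<sigma> = (\<Sum>i\<in>{0<..<length \<sigma>}. fert (take i \<sigma>) * fert (drop i \<sigma>))"
  unfolding cut_conv_def
  by (rule sum.mono_neutral_cong_right) (auto simp: fert1_def)

lemma fert_conv_fert:
  assumes "\<sigma> \<noteq> []"
  shows "(fert \<star> fert) \<sigma> = 2 * fert \<sigma> + (fert1 \<star> fert1) \<sigma>"
  using assms unfolding fert1_conv_eq_inner_sum
  by (subst cut_conv_def, subst sum_split_ends) auto

lemma sum_squares_le_square_sum:
  fixes g :: "'a \<Rightarrow> real"
  assumes "finite A" "\<And>x. x \<in> A \<Longrightarrow> 0 \<le> g x"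
  shows "(\<Sum>x\<in>A. (g x)\<^sup>2) \<le> (\<Sum>x\<in>A. g x)\<^sup>2"
proof -
  have "(\<Sum>x\<in>A. (g x)\<^sup>2) \<le> (\<Sum>x\<in>A. g x * sum g A)"
    unfolding power2_eq_square using assms
    by (intro sum_mono mult_left_mono member_le_sum) auto
  also have "\<dots> = (sum g A)\<^sup>2" by (simp add: power2_eq_square sum_distrib_right)
  finally show ?thesis .
qed

text \<open>
  Write \<open>fert (\<tau> @ [m]) = 2 * fert \<tau> + q\<close>, with \<open>q\<close> the sum over proper cuts. The square is
  \<open>4 * (fert \<tau>)\<^sup>2 + 4 * overlap \<tau> + q\<^sup>2\<close>, and the diagonal of \<open>q\<^sup>2\<close> together with two of the four
  squares is the convolution. The only loss is the product of two different proper cuts.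
\<close>
lemma square_fert_conv_lower:
  "((\<lambda>\<sigma>. fert \<sigma> * fert \<sigma>) \<star> (\<lambda>\<sigma>. fert \<sigma> * fert \<sigma>)) \<tau> + 2 * (fert1 \<tau> * fert1 \<tau>) + 4 * overlap \<tau>
     \<le> (fert \<star> fert) \<tau> * (fert \<star> fert) \<tau>"
proof (cases "\<tau> = []")
  case False
  define q where "q = (fert1 \<star> fert1) \<tau>"
  have "((\<lambda>\<sigma>. fert \<sigma> * fert \<sigma>) \<star> (\<lambda>\<sigma>. fert \<sigma> * fert \<sigma>)) \<tau>
        = 2 * (fert \<tau> * fert \<tau>) + (\<Sum>i\<in>{0<..<length \<tau>}. (fert (take i \<tau>) * fert (drop i \<tau>))\<^sup>2)"
    using False by (subst cut_conv_def, subst sum_split_ends) (auto simp: power2_eq_square mult_ac)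
  also have "(\<Sum>i\<in>{0<..<length \<tau>}. (fert (take i \<tau>) * fert (drop i \<tau>))\<^sup>2) \<le> q\<^sup>2"
    unfolding q_def fert1_conv_eq_inner_sum by (rule sum_squares_le_square_sum) auto
  finally have "((\<lambda>\<sigma>. fert \<sigma> * fert \<sigma>) \<star> (\<lambda>\<sigma>. fert \<sigma> * fert \<sigma>)) \<tau> \<le> 2 * (fert \<tau> * fert \<tau>) + q\<^sup>2"
    by simp
  moreover have "(fert \<star> fert) \<tau> * (fert \<star> fert) \<tau> = 4 * (fert \<tau> * fert \<tau>) + 4 * (fert \<tau> * q) + q\<^sup>2"
    unfolding fert_conv_fert[OF False] q_def[symmetric] by (simp add: power2_eq_square algebra_simps)
  ultimately show ?thesis
    using False by (simp add: overlap_def fert1_def flip: q_def)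
qed (simp add: cut_conv_def overlap_def)

lemma fert1_conv_fert1_snoc:
  assumes "\<forall>y\<in>set \<tau>. y < m"
  shows "(fert1 \<star> fert1) (\<tau> @ [m]) = (fert1 \<star> (fert \<star> fert)) \<tau>"
proof -
  have "fert1 (drop i \<tau> @ [m]) = (fert \<star> fert) (drop i \<tau>)" for i
    using fert_snoc[of "drop i \<tau>" m] assms by (auto simp: fert1_def dest: in_set_dropD)
  thus ?thesis by (simp add: cut_conv_def)
qed

text \<open>
  If \<open>m\<close> exceeds all entries of \<open>\<tau>\<close>, the right-hand side is \<open>overlap (\<tau> @ [m])\<close>. For each proper
  cut of \<open>\<tau>\<close> into \<open>\<alpha>\<close> and \<open>\<gamma>\<close>, the factor \<open>(fert \<star> fert) \<tau>\<close> is at least the contribution of its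
  two trivial cuts and of the cut at the same place, \<open>2 * fert \<tau> + fert \<alpha> * fert \<gamma>\<close>. Multiplied by
  \<open>fert \<alpha> * (2 * fert \<gamma> + (fert1 \<star> fert1) \<gamma>)\<close>, this gives four products, of which three appear on
  the left and one is dropped. When \<open>\<gamma>\<close> is empty, only the first term on the left is present.
\<close>
lemma overlap_snoc_lower:
  "2 * ((\<lambda>\<sigma>. fert1 \<sigma> * fert1 \<sigma>) \<star> (\<lambda>\<sigma>. fert \<sigma> * fert \<sigma>)) \<tau>
     + ((\<lambda>\<sigma>. fert1 \<sigma> * fert1 \<sigma>) \<star> overlap) \<tau> + 4 * overlap \<tau>
     \<le> (fert \<star> fert) \<tau> * (fert1 \<star> (fert \<star> fert)) \<tau>"
proof -
  have "2 * (fert1 \<alpha> * fert1 \<alpha> * (fert \<gamma> * fert \<gamma>)) + fert1 \<alpha> * fert1 \<alpha> * overlap \<gamma>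
          + 4 * (fert \<tau> * (fert1 \<alpha> * fert1 \<gamma>))
        \<le> (fert \<star> fert) \<tau> * (fert1 \<alpha> * (fert \<star> fert) \<gamma>)"
    if i: "i \<le> length \<tau>" and \<alpha>: "\<alpha> = take i \<tau>" and \<gamma>: "\<gamma> = drop i \<tau>" for i \<alpha> \<gamma>
  proof (cases "\<alpha> = [] \<or> \<gamma> = []")
    case True
    show ?thesis
    proof (cases "\<alpha> = []")
      case False
      with True have [simp]: "\<gamma> = []" by simp
      hence [simp]: "\<alpha> = \<tau>" using i \<alpha> \<gamma> by auto
      have "2 * fert \<tau> \<le> (fert \<star> fert) \<tau>"
        using False by (simp add: fert_conv_fert cut_conv_nonneg)
      hence "2 * fert \<tau> * fert \<tau> \<le> (fert \<star> fert) \<tau> * fert \<tau>"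
        by (intro mult_right_mono) auto
      thus ?thesis using False by (simp add: overlap_def cut_conv_def fert1_def mult_ac)
    qed simp
  next
    case False
    hence ne: "\<tau> \<noteq> []" "i \<in> {0<..<length \<tau>}" using \<alpha> \<gamma> by auto
    have "fert \<alpha> * fert \<gamma> \<le> (fert1 \<star> fert1) \<tau>"
      unfolding fert1_conv_eq_inner_sum \<alpha> \<gamma>
      by (rule member_le_sum[OF ne(2), of "\<lambda>i. fert (take i \<tau>) * fert (drop i \<tau>)"]) auto
    hence "2 * fert \<tau> + fert \<alpha> * fert \<gamma> \<le> (fert \<star> fert) \<tau>"
      by (simp add: fert_conv_fert[OF ne(1)])
    hence "(2 * fert \<tau> + fert \<alpha> * fert \<gamma>) * (fert \<alpha> * (fert \<star> fert) \<gamma>)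
            \<le> (fert \<star> fert) \<tau> * (fert \<alpha> * (fert \<star> fert) \<gamma>)"
      by (rule mult_right_mono) (simp add: cut_conv_nonneg)
    moreover have "(2 * fert \<tau> + fert \<alpha> * fert \<gamma>) * (fert \<alpha> * (fert \<star> fert) \<gamma>)
        = 2 * (fert \<alpha> * fert \<alpha> * (fert \<gamma> * fert \<gamma>)) + fert \<alpha> * fert \<alpha> * overlap \<gamma>
          + 4 * (fert \<tau> * (fert \<alpha> * fert \<gamma>)) + 2 * (fert \<tau> * fert \<alpha> * (fert1 \<star> fert1) \<gamma>)"
      using False by (simp add: fert_conv_fert overlap_def algebra_simps)
    moreover have "0 \<le> fert \<tau> * fert \<alpha> * (fert1 \<star> fert1) \<gamma>"
      by (intro mult_nonneg_nonneg cut_conv_nonneg) auto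
    ultimately show ?thesis using False by (simp add: fert1_def)
  qed
  hence "(\<Sum>i\<le>length \<tau>. 2 * (fert1 (take i \<tau>) * fert1 (take i \<tau>) * (fert (drop i \<tau>) * fert (drop i \<tau>)))
              + fert1 (take i \<tau>) * fert1 (take i \<tau>) * overlap (drop i \<tau>)
              + 4 * (fert \<tau> * (fert1 (take i \<tau>) * fert1 (drop i \<tau>))))
        \<le> (\<Sum>i\<le>length \<tau>. (fert \<star> fert) \<tau> * (fert1 (take i \<tau>) * (fert \<star> fert) (drop i \<tau>)))"
    by (intro sum_mono) auto
  thus ?thesis
    by (simp add: sum.distrib cut_conv_def[of "\<lambda>\<sigma>. fert1 \<sigma> * fert1 \<sigma>"] cut_conv_def[of fert1]
                  overlap_def[of \<tau>] sum_distrib_left)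
qed

section \<open>Recurrences for the degree of noninvertibility\<close>

definition degree_mean :: "nat \<Rightarrow> real" where
  "degree_mean = perm_mean (\<lambda>\<sigma>. fert \<sigma> * fert \<sigma>)"

definition overlap_mean :: "nat \<Rightarrow> real" where
  "overlap_mean = perm_mean overlap"

text \<open>
  Sorting does not change the multiset of entries, so every preimage of a permutation of \<open>{1..n}\<close> is
  again one, and the fibres within \<open>S\<^sub>n\<close> are the full fibres. The degree is therefore the mean of the
  squared fertility.
\<close>
lemma deg_noninv_stack_sort:
  "deg_noninv (permutations_of_set {1..n}) stack_sort = degree_mean n"
proof -
  have "stack_sort -` {\<sigma>} \<inter> permutations_of_set {1..n} = {\<pi>. stack_sort \<pi> = \<sigma>}"
    if "\<sigma> \<in> permutations_of_set {1..n}" for \<sigma>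
  proof -
    have "\<pi> \<in> permutations_of_set {1..n}" if "stack_sort \<pi> = \<sigma>" for \<pi>
    proof -
      have "mset \<pi> = mset \<sigma>" using mset_stack_sort[of \<pi>] that by simp
      hence "set \<pi> = set \<sigma>" "distinct \<pi> = distinct \<sigma>"
        by (auto dest: mset_eq_setD mset_eq_imp_distinct_iff)
      thus ?thesis using \<open>\<sigma> \<in> _\<close> by (simp add: permutations_of_set_def)
    qed
    thus ?thesis by blast
  qed
  hence "(\<Sum>\<sigma>\<in>permutations_of_set {1..n}.
            (real (card (stack_sort -` {\<sigma>} \<inter> permutations_of_set {1..n})))\<^sup>2)
         = perm_sum (\<lambda>\<sigma>. fert \<sigma> * fert \<sigma>) {1..n}"
    unfolding perm_sum_def fert_def power2_eq_square by (intro sum.cong refl) simp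
  also have "\<dots> = fact n * degree_mean n"
    using perm_sum_eq_perm_mean[OF pattern_invariant_mult[OF pattern_invariant_fert
      pattern_invariant_fert], of "{1..n}"]
    by (simp add: degree_mean_def)
  finally show ?thesis by (simp add: deg_noninv_def)
qed

lemma perm_mean_fert1_square:
  "perm_mean (\<lambda>\<sigma>. fert1 \<sigma> * fert1 \<sigma>) n = (if n = 0 then 0 else degree_mean n)"
proof (cases "n = 0")
  case False
  have "fert1 \<sigma> = fert \<sigma>" if "\<sigma> \<in> permutations_of_set {..<n}" for \<sigma>
  proof -
    have "length \<sigma> = n" using length_finite_permutations_of_set[OF that] by simp
    thus ?thesis using False by (auto simp: fert1_def)
  qed
  thus ?thesis using False by (simp add: degree_mean_def perm_mean_def perm_sum_def)
qed (simp add: perm_mean_def perm_sum_def)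

lemma pattern_invariant_fert_square: "pattern_invariant (\<lambda>\<sigma>. fert \<sigma> * fert \<sigma>)"
  by (intro pattern_invariant_mult pattern_invariant_fert)

lemma pattern_invariant_fert1_square: "pattern_invariant (\<lambda>\<sigma>. fert1 \<sigma> * fert1 \<sigma>)"
  by (intro pattern_invariant_mult pattern_invariant_fert1)

lemma pattern_invariant_overlap: "pattern_invariant overlap"
  using pattern_invariant_mult[OF pattern_invariant_fert
    pattern_invariant_cut_conv[OF pattern_invariant_fert1 pattern_invariant_fert1]]
  by (simp add: overlap_def[abs_def])

text \<open>
  With \<open>B\<close> and \<open>E\<close> the generating functions of \<open>degree_mean\<close> and \<open>overlap_mean\<close>, this is
  \<open>B' \<ge> B\<^sup>2 + 2 (B - 1) + 4 E\<close>, coefficient by coefficient.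
\<close>
lemma degree_mean_Suc:
  "(\<Sum>k\<le>n. degree_mean k * degree_mean (n - k)) + 2 * (if n = 0 then 0 else degree_mean n)
     + 4 * overlap_mean n \<le> real (Suc n) * degree_mean (Suc n)"
proof -
  let ?sq = "\<lambda>\<sigma>. fert \<sigma> * fert \<sigma>"
  let ?\<psi> = "\<lambda>\<tau>. (?sq \<star> ?sq) \<tau> + 2 * (fert1 \<tau> * fert1 \<tau>) + 4 * overlap \<tau>"
  have "perm_mean ?\<psi> n \<le> real (Suc n) * perm_mean ?sq (Suc n)"
  proof (rule perm_mean_Suc)
    show "\<forall>y\<in>set \<tau>. y < m" if "distinct (\<tau> @ [m])" "?sq (\<tau> @ [m]) \<noteq> 0" for \<tau> m
      using fert_snoc_nonzero[of \<tau> m] that by simp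
    show "?\<psi> \<tau> \<le> ?sq (\<tau> @ [m])" if "\<forall>y\<in>set \<tau>. y < m" for \<tau> m
      using square_fert_conv_lower[of \<tau>] by (simp add: fert_snoc[OF that])
  qed
  thus ?thesis
    by (simp add: perm_mean_add perm_mean_cmult perm_mean_fert1_square
        perm_mean_cut_conv pattern_invariant_fert_square degree_mean_def overlap_mean_def)
qed

text \<open>
  In the same notation, \<open>E' \<ge> (B - 1) (2 B + E) + 4 E\<close>.
\<close>
lemma overlap_mean_Suc:
  "(\<Sum>k\<le>n. (if k = 0 then 0 else degree_mean k) * (2 * degree_mean (n - k) + overlap_mean (n - k)))
     + 4 * overlap_mean n \<le> real (Suc n) * overlap_mean (Suc n)"
proof -
  let ?sq = "\<lambda>\<sigma>. fert \<sigma> * fert \<sigma>" and ?sq1 = "\<lambda>\<sigma>. fert1 \<sigma> * fert1 \<sigma>"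
  let ?\<psi> = "\<lambda>\<tau>. 2 * (?sq1 \<star> ?sq) \<tau> + (?sq1 \<star> overlap) \<tau> + 4 * overlap \<tau>"
  have "perm_mean ?\<psi> n \<le> real (Suc n) * perm_mean overlap (Suc n)"
  proof (rule perm_mean_Suc)
    show "\<forall>y\<in>set \<tau>. y < m" if "distinct (\<tau> @ [m])" "overlap (\<tau> @ [m]) \<noteq> 0" for \<tau> m
      using fert_snoc_nonzero[of \<tau> m] that by (simp add: overlap_def)
    show "?\<psi> \<tau> \<le> overlap (\<tau> @ [m])" if "\<forall>y\<in>set \<tau>. y < m" for \<tau> m
      using overlap_snoc_lower[of \<tau>]
      by (simp add: overlap_def[of "\<tau> @ [m]"] fert_snoc[OF that] fert1_conv_fert1_snoc[OF that])
  qed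
  hence "2 * (\<Sum>k\<le>n. (if k = 0 then 0 else degree_mean k) * degree_mean (n - k))
      + (\<Sum>k\<le>n. (if k = 0 then 0 else degree_mean k) * overlap_mean (n - k)) + 4 * overlap_mean n
      \<le> real (Suc n) * overlap_mean (Suc n)"
    unfolding perm_mean_add perm_mean_cmult overlap_mean_def
      perm_mean_cut_conv[OF pattern_invariant_fert1_square pattern_invariant_fert_square]
      perm_mean_cut_conv[OF pattern_invariant_fert1_square pattern_invariant_overlap]
      perm_mean_fert1_square degree_mean_def[symmetric] .
  thus ?thesis
    by (simp add: sum_distrib_left sum.distrib distrib_left mult_ac)
qed

lemma overlap_mean_nonneg: "0 \<le> overlap_mean n"
  by (simp add: overlap_mean_def perm_mean_def perm_sum_def overlap_nonneg sum_nonneg)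

lemma degree_mean_0 [simp]: "degree_mean 0 = 1"
  by (simp add: degree_mean_def perm_mean_def perm_sum_def)

lemma degree_mean_nonneg: "0 \<le> degree_mean n"
  by (simp add: degree_mean_def perm_mean_def perm_sum_def sum_nonneg)

lemma sum_degree_mean_le:
  "(\<Sum>k\<le>n. degree_mean k * degree_mean (n - k)) \<le> real (Suc n) * degree_mean (Suc n)"
  by (rule order_trans[OF _ degree_mean_Suc]) (simp add: degree_mean_nonneg overlap_mean_nonneg)

text \<open>
  The constant sequence \<open>1\<close> satisfies the convolution recurrence with equality.
\<close>
lemma degree_mean_ge_1: "1 \<le> degree_mean n"
proof (induction n rule: less_induct)
  case (less n)
  show ?case
  proof (cases n)
    case (Suc k)
    have "1 \<le> degree_mean i * degree_mean (k - i)" if "i \<le> k" for i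
      using less.IH[of i] less.IH[of "k - i"] that Suc mult_mono[of 1 "degree_mean i" 1] by simp
    hence "(\<Sum>i\<le>k. 1) \<le> (\<Sum>i\<le>k. degree_mean i * degree_mean (k - i))"
      by (intro sum_mono) simp
    hence "real (Suc k) \<le> (\<Sum>i\<le>k. degree_mean i * degree_mean (k - i))" by simp
    also have "\<dots> \<le> real (Suc k) * degree_mean (Suc k)"
      by (rule sum_degree_mean_le)
    finally have "real (Suc k) * 1 \<le> real (Suc k) * degree_mean (Suc k)" by (simp only: mult_1_right)
    thus ?thesis using Suc by (simp only: mult_le_cancel_left_pos of_nat_0_less_iff zero_less_Suc)
  qed simp
qed

text \<open>
  One summand of the convolution; this is the supermultiplicativity, up to a linear factor, from which
  the limit is obtained.
\<close>
lemma degree_mean_mult_le: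
  "degree_mean i * degree_mean j \<le> real (Suc (i + j)) * degree_mean (Suc (i + j))"
proof -
  have "degree_mean i * degree_mean ((i + j) - i)
          \<le> (\<Sum>k\<le>i + j. degree_mean k * degree_mean ((i + j) - k))"
    by (rule member_le_sum) (auto intro: mult_nonneg_nonneg degree_mean_nonneg)
  also have "\<dots> \<le> real (Suc (i + j)) * degree_mean (Suc (i + j))"
    by (rule sum_degree_mean_le)
  finally show ?thesis by (simp only: diff_add_inverse)
qed

fun catalan :: "nat \<Rightarrow> real" where
  "catalan 0 = 1"
| "catalan (Suc n) = (\<Sum>k\<le>n. catalan k * catalan (n - k))"

lemma catalan_nonneg: "0 \<le> catalan n"
  by (induction n rule: catalan.induct) (auto intro!: sum_nonneg)

text \<open>
  The generating function \<open>C\<close> of the Catalan numbers satisfies \<open>C = 1 + x C\<^sup>2\<close>, and at \<open>x = 1 / 4\<close> the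
  value \<open>2\<close> is a fixed point of the right-hand side. Partial sums therefore stay below it.
\<close>
lemma catalan_partial_sum_le: "(\<Sum>n<N. catalan n / 4 ^ n) \<le> 2"
proof (induction N)
  case (Suc N)
  let ?c = "\<lambda>n. catalan n / 4 ^ n"
  have "?c (Suc n) = (\<Sum>k\<le>n. ?c k * ?c (n - k)) / 4" for n
  proof -
    have "catalan k / 4 ^ k * (catalan (n - k) / 4 ^ (n - k))
          = catalan k * catalan (n - k) / 4 ^ n" if "k \<le> n" for k
      using that by (simp add: power_add[symmetric])
    hence "(\<Sum>k\<le>n. ?c k * ?c (n - k)) = (\<Sum>k\<le>n. catalan k * catalan (n - k) / 4 ^ n)"
      by (intro sum.cong) auto
    thus ?thesis by (simp add: sum_divide_distrib[symmetric] mult.commute)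
  qed
  hence "(\<Sum>n<Suc N. ?c n) = 1 + (\<Sum>n<N. \<Sum>k\<le>n. ?c k * ?c (n - k)) / 4"
    unfolding sum.lessThan_Suc_shift by (simp add: sum_divide_distrib)
  also have "(\<Sum>n<N. \<Sum>k\<le>n. ?c k * ?c (n - k)) = (\<Sum>(i, j)\<in>{(i, j). i + j < N}. ?c i * ?c j)"
    by (rule sum.triangle_reindex[symmetric])
  also have "\<dots> \<le> (\<Sum>(i, j)\<in>{..<N} \<times> {..<N}. ?c i * ?c j)"
    by (rule sum_mono2) (auto intro!: mult_nonneg_nonneg divide_nonneg_nonneg catalan_nonneg)
  also have "\<dots> = (\<Sum>n<N. ?c n) * (\<Sum>n<N. ?c n)"
    by (simp only: sum_product sum.cartesian_product)
  also have "\<dots> \<le> 2 * 2"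
    using Suc.IH by (intro mult_mono)
      (auto intro!: sum_nonneg divide_nonneg_nonneg catalan_nonneg)
  finally show ?case by simp
qed simp

lemma fert_le_catalan: "distinct \<sigma> \<Longrightarrow> fert \<sigma> \<le> catalan (length \<sigma>)"
proof (induction "length \<sigma>" arbitrary: \<sigma> rule: less_induct)
  case less
  show ?case
  proof (cases \<sigma> rule: rev_cases)
    case (snoc \<tau> m)
    show ?thesis
    proof (cases "\<forall>y\<in>set \<tau>. y < m")
      case True
      have "fert \<sigma> = (\<Sum>i\<le>length \<tau>. fert (take i \<tau>) * fert (drop i \<tau>))"
        using fert_snoc[OF True] by (simp add: snoc cut_conv_def)
      also have "\<dots> \<le> (\<Sum>i\<le>length \<tau>. catalan i * catalan (length \<tau> - i))"
      proof (intro sum_mono mult_mono)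
        fix i assume "i \<in> {..length \<tau>}"
        thus "fert (take i \<tau>) \<le> catalan i" "fert (drop i \<tau>) \<le> catalan (length \<tau> - i)"
          using less.hyps[of "take i \<tau>"] less.hyps[of "drop i \<tau>"] less.prems
          by (simp_all add: snoc min_absorb2)
      qed (auto simp: catalan_nonneg)
      finally show ?thesis by (simp add: snoc)
    next
      case False
      hence "fert \<sigma> = 0" using fert_snoc_nonzero[of \<tau> m] less.prems by (auto simp: snoc)
      thus ?thesis by (simp add: catalan_nonneg)
    qed
  qed simp
qed

text \<open>
  Any exponential bound serves here: it keeps the growth rate finite.
\<close>
lemma degree_mean_le: "degree_mean n \<le> 4 * 16 ^ n"
proof -
  have "catalan n / 4 ^ n \<le> (\<Sum>k<Suc n. catalan k / 4 ^ k)"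
    by (rule member_le_sum) (auto intro: divide_nonneg_nonneg catalan_nonneg)
  hence "catalan n / 4 ^ n \<le> 2" using catalan_partial_sum_le[of "Suc n"] by linarith
  hence cat: "catalan n \<le> 2 * 4 ^ n" by (simp add: field_simps)
  have "fert \<sigma> * fert \<sigma> \<le> 4 * 16 ^ n" if "\<sigma> \<in> permutations_of_set {..<n}" for \<sigma>
  proof -
    have "length \<sigma> = n" "distinct \<sigma>"
      using length_finite_permutations_of_set[OF that] permutations_of_setD[OF that] by simp_all
    hence "fert \<sigma> \<le> 2 * 4 ^ n" using fert_le_catalan[of \<sigma>] cat by simp
    hence "fert \<sigma> * fert \<sigma> \<le> (2 * 4 ^ n) * (2 * 4 ^ n)" by (intro mult_mono) auto
    also have "\<dots> = 4 * 16 ^ n" by (simp add: power_mult_distrib[symmetric])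
    finally show ?thesis .
  qed
  hence "perm_sum (\<lambda>\<sigma>. fert \<sigma> * fert \<sigma>) {..<n} \<le> fact n * (4 * 16 ^ n)"
    unfolding perm_sum_def
    using sum_bounded_above[of "permutations_of_set {..<n}" "\<lambda>\<sigma>. fert \<sigma> * fert \<sigma>" "4 * 16 ^ n"]
    by simp
  thus ?thesis by (simp add: degree_mean_def perm_mean_def divide_simps mult_ac)
qed

section \<open>A Fekete lemma for balanced sums\<close>

text \<open>
  The number \<open>i * n + r\<close> is a sum of \<open>i\<close> parts, each equal to \<open>n\<close> or \<open>Suc n\<close>. Halving \<open>i\<close> and \<open>r\<close>
  separately keeps both summands of this form and within a factor \<open>3\<close> of each other. Every
  \<open>p \<ge> n * n\<close> has this form with \<open>i = p div n\<close> and \<open>r = p mod n\<close>.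
\<close>
lemma balanced_superadditive_iterate:
  fixes a :: "nat \<Rightarrow> real"
  assumes super: "\<And>p q. 1 \<le> p \<Longrightarrow> p \<le> q \<Longrightarrow> q \<le> 3 * p \<Longrightarrow> a p + a q \<le> a (p + q)"
    and "1 \<le> n" "1 \<le> i" "r \<le> i"
  shows "real i * min (a n) (a (Suc n)) \<le> a (i * n + r)"
  using assms(3,4)
proof (induction i arbitrary: r rule: less_induct)
  case (less i)
  show ?case
  proof (cases "i = 1")
    case True
    hence "r = 0 \<or> r = 1" using less.prems by auto
    thus ?thesis using True by auto
  next
    case False
    define i1 i2 r1 r2 where "i1 = i div 2" and "i2 = i - i div 2"
      and "r1 = r div 2" and "r2 = r - r div 2"
    have i: "1 \<le> i1" "i1 \<le> i2" "i2 \<le> 2 * i1" "i1 + i2 = i" "i2 < i" "i1 < i"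
      and r: "r1 \<le> i1" "r2 \<le> i2" "r1 + r2 = r" "r1 \<le> r2" "r2 \<le> r1 + 1"
      using False less.prems unfolding i1_def i2_def r1_def r2_def by linarith+
    define s t where "s = i1 * n" and "t = i2 * n"
    have "s \<le> t" "t \<le> 2 * s" "1 \<le> s"
      unfolding s_def t_def
      using i \<open>1 \<le> n\<close> mult_right_mono[of i2 "2 * i1" n] by (simp_all add: Suc_le_eq)
    moreover have "t + r2 \<le> 2 * s + (r1 + 1)"
      using \<open>t \<le> 2 * s\<close> r(5) by (rule add_mono)
    ultimately have "a (s + r1) + a (t + r2) \<le> a ((s + r1) + (t + r2))"
      using r(4) by (intro super) simp_all
    hence "a (i1 * n + r1) + a (i2 * n + r2) \<le> a ((i1 * n + r1) + (i2 * n + r2))"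
      by (simp only: s_def t_def)
    also have "(i1 * n + r1) + (i2 * n + r2) = i * n + r"
      unfolding i(4)[symmetric] r(3)[symmetric] by (simp add: algebra_simps)
    finally have "a (i1 * n + r1) + a (i2 * n + r2) \<le> a (i * n + r)" .
    moreover have "real i1 * min (a n) (a (Suc n)) \<le> a (i1 * n + r1)"
      using i r by (intro less.IH) auto
    moreover have "real i2 * min (a n) (a (Suc n)) \<le> a (i2 * n + r2)"
      using i r by (intro less.IH) auto
    moreover have "real i * min (a n) (a (Suc n))
        = real i1 * min (a n) (a (Suc n)) + real i2 * min (a n) (a (Suc n))"
      unfolding i(4)[symmetric] by (simp add: algebra_simps)
    ultimately show ?thesis by linarith
  qed
qed

lemma real_div_over_self_tendsto:
  assumes "1 \<le> n"
  shows "(\<lambda>p. real (p div n) / real p) \<longlonglongrightarrow> 1 / real n"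
proof (rule tendsto_sandwich)
  show "\<forall>\<^sub>F p in sequentially. 1 / real n - 1 / real p \<le> real (p div n) / real p"
  proof (rule eventually_sequentiallyI[of 1])
    fix p :: nat assume "1 \<le> p"
    have "p div n * n + p mod n \<le> p div n * n + n"
      using assms by (intro add_left_mono less_imp_le) simp
    hence "p \<le> (p div n + 1) * n" by simp
    hence "real p \<le> real ((p div n + 1) * n)" by (simp only: of_nat_le_iff)
    hence "real p / real n \<le> real (p div n) + 1"
      using assms by (simp add: field_simps)
    hence "real p / real n / real p \<le> (real (p div n) + 1) / real p"
      by (rule divide_right_mono) simp
    thus "1 / real n - 1 / real p \<le> real (p div n) / real p"
      using \<open>1 \<le> p\<close> by (simp add: add_divide_distrib)
  qed
  show "\<forall>\<^sub>F p in sequentially. real (p div n) / real p \<le> 1 / real n"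
  proof (rule eventually_sequentiallyI[of 1])
    fix p :: nat assume "1 \<le> p"
    have "(p div n) * n \<le> p" by simp
    hence "real ((p div n) * n) \<le> real p" by (simp only: of_nat_le_iff)
    hence "real (p div n) \<le> real p / real n"
      using assms by (simp add: field_simps)
    hence "real (p div n) / real p \<le> real p / real n / real p"
      by (rule divide_right_mono) simp
    thus "real (p div n) / real p \<le> 1 / real n"
      using \<open>1 \<le> p\<close> by simp
  qed
  show "(\<lambda>p. 1 / real n - 1 / real p) \<longlonglongrightarrow> 1 / real n" by real_asymp
qed simp

text \<open>
  Fekete's lemma when superadditivity is known for balanced sums only. The price is that two
  consecutive arguments \<open>n\<close> and \<open>Suc n\<close> are needed as building blocks, so \<open>a n / n\<close> is a lower bound
  for the limit inferior only after a loss \<open>\<delta> n\<close>; as \<open>\<delta>\<close> tends to \<open>0\<close>, the limit is the supremum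
  of \<open>a n / n - \<delta> n\<close>.
\<close>
lemma balanced_fekete:
  fixes a :: "nat \<Rightarrow> real"
  assumes super: "\<And>p q. 1 \<le> p \<Longrightarrow> p \<le> q \<Longrightarrow> q \<le> 3 * p \<Longrightarrow> a p + a q \<le> a (p + q)"
    and slow: "\<And>n. 1 \<le> n \<Longrightarrow> a n - ln (real n + 1) \<le> a (Suc n)"
    and bound: "\<And>n. 1 \<le> n \<Longrightarrow> a n \<le> C * real n"
  shows "convergent (\<lambda>n. a n / real n)"
proof -
  define \<delta> where "\<delta> n = ln (real n + 1) / real n" for n :: nat
  define x where "x n = a n / real n - \<delta> n" for n
  have \<delta>_nonneg: "0 \<le> \<delta> n" for n by (simp add: \<delta>_def)
  have \<delta>_lim: "\<delta> \<longlonglongrightarrow> 0" unfolding \<delta>_def[abs_def] by real_asymp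
  have bdd: "bdd_above (x ` {1..})"
  proof (rule bdd_aboveI2)
    fix n :: nat assume "n \<in> {1..}"
    hence "a n / real n \<le> C" using bound[of n] by (simp add: field_simps)
    thus "x n \<le> C" using \<delta>_nonneg[of n] by (simp add: x_def)
  qed
  define L where "L = (SUP n\<in>{1..}. x n)"
  have lower: "\<forall>\<^sub>F p in sequentially. l < a p / real p" if l: "l < x n" and n: "1 \<le> n" for l n
  proof -
    define m where "m = min (a n) (a (Suc n))"
    have "a n - ln (real n + 1) \<le> m"
      using slow[OF n] by (auto simp: m_def)
    hence "x n \<le> m / real n"
      unfolding x_def \<delta>_def diff_divide_distrib[symmetric] by (rule divide_right_mono) simp
    hence "l < 1 / real n * m" using l by simp
    moreover have "(\<lambda>p. real (p div n) / real p * m) \<longlonglongrightarrow> 1 / real n * m"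
      by (intro tendsto_mult tendsto_const real_div_over_self_tendsto n)
    ultimately have "\<forall>\<^sub>F p in sequentially. l < real (p div n) / real p * m"
      by (rule order_tendstoD(1)[rotated])
    moreover have "\<forall>\<^sub>F p in sequentially. real (p div n) / real p * m \<le> a p / real p"
    proof (rule eventually_sequentiallyI[of "n * n"])
      fix p assume p: "n * n \<le> p"
      have "n \<le> p div n" using p n by (simp add: less_eq_div_iff_mult_less_eq)
      moreover have "p mod n < n" using n by simp
      ultimately have "p mod n \<le> p div n" by simp
      moreover have "1 \<le> p div n" using n \<open>n \<le> p div n\<close> by simp
      ultimately have "real (p div n) * m \<le> a (p div n * n + p mod n)"
        unfolding m_def using n by (intro balanced_superadditive_iterate super) auto
      thus "real (p div n) / real p * m \<le> a p / real p"
        by (simp add: divide_right_mono)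
    qed
    ultimately show ?thesis by eventually_elim linarith
  qed
  have "(\<lambda>n. a n / real n) \<longlonglongrightarrow> L"
  proof (rule order_tendstoI)
    fix l assume "l < L"
    then obtain n where "1 \<le> n" "l < x n"
      unfolding L_def using less_cSUP_iff[OF _ bdd] by auto
    thus "\<forall>\<^sub>F p in sequentially. l < a p / real p" by (intro lower)
  next
    fix u assume "L < u"
    have "\<forall>\<^sub>F p in sequentially. \<delta> p < u - L"
      using \<delta>_lim \<open>L < u\<close> by (intro order_tendstoD(2)) auto
    moreover have "\<forall>\<^sub>F p in sequentially. x p \<le> L"
      unfolding L_def using bdd
      by (intro eventually_sequentiallyI[of 1] cSUP_upper) auto
    ultimately show "\<forall>\<^sub>F p in sequentially. a p / real p < u"
      by eventually_elim (simp add: x_def)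
  qed
  thus ?thesis by (rule convergentI)
qed

section \<open>Existence of the growth rate\<close>

text \<open>
  The maximum of the new word uses up one letter, so the shifted sequence \<open>D n = degree_mean (n - 1)\<close>
  satisfies \<open>D p * D q \<le> (p + q) * D (p + q)\<close>. In unbalanced sums such as repeated
  additions of a fixed \<open>p\<close>, the factors \<open>p + q\<close> accumulate to a factorial. For \<open>p \<le> q \<le> 3 p\<close>,
  however, \<open>(p + q)\<^sup>2 \<le> (2 q) (4 p) = 8 p q\<close>, and dividing \<open>D n\<close> by
  \<open>8 n\<close> then removes the factor altogether.
\<close>
lemma convergent_ln_degree_mean: "convergent (\<lambda>n. ln (degree_mean n) / real n)"
proof -
  define D where "D n = degree_mean (n - 1)" for n
  define a where "a n = ln (D n / (8 * real n))" for n
  have D_pos: "0 < D n" for n using degree_mean_ge_1[of "n - 1"] by (simp add: D_def)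
  have D_mult: "D p * D q \<le> real (p + q) * D (p + q)" if pq: "1 \<le> p" "1 \<le> q" for p q
  proof -
    have idx: "Suc ((p - 1) + (q - 1)) = p + q - 1" using pq by simp
    have "D p * D q \<le> real (p + q - 1) * D (p + q)"
      unfolding D_def using degree_mean_mult_le[of "p - 1" "q - 1"] unfolding idx .
    also have "\<dots> \<le> real (p + q) * D (p + q)"
      using D_pos[of "p + q"] by (intro mult_right_mono) auto
    finally show ?thesis .
  qed
  have "convergent (\<lambda>n. a n / real n)"
  proof (rule balanced_fekete)
    fix p q :: nat assume pq: "1 \<le> p" "p \<le> q" "q \<le> 3 * p"
    have "real (p + q) * real (p + q) \<le> (2 * real q) * (4 * real p)"
      using pq by (intro mult_mono) auto
    hence sq: "real (p + q) * real (p + q) \<le> 8 * real p * real q" by (simp add: mult_ac)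
    have "D p * D q * real (p + q) \<le> (real (p + q) * D (p + q)) * real (p + q)"
      using D_mult[of p q] pq by (intro mult_right_mono) auto
    also have "\<dots> \<le> 8 * real p * real q * D (p + q)"
      using mult_right_mono[OF sq, of "D (p + q)"] D_pos[of "p + q"] by (simp add: mult_ac)
    finally have main: "D p * D q * real (p + q) \<le> 8 * real p * real q * D (p + q)" .
    have "D p / (8 * real p) * (D q / (8 * real q))
        = D p * D q * real (p + q) / (64 * real p * real q * real (p + q))"
      using pq by simp
    also have "\<dots> \<le> 8 * real p * real q * D (p + q) / (64 * real p * real q * real (p + q))"
      using main by (rule divide_right_mono) simp
    also have "\<dots> = D (p + q) / (8 * real (p + q))"
      using pq by (simp del: of_nat_add)
    finally have "D p / (8 * real p) * (D q / (8 * real q)) \<le> D (p + q) / (8 * real (p + q))" .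
    hence "ln (D p / (8 * real p) * (D q / (8 * real q))) \<le> a (p + q)"
      unfolding a_def using pq D_pos by (intro ln_mono) auto
    moreover have "ln (D p / (8 * real p) * (D q / (8 * real q))) = a p + a q"
      unfolding a_def using pq D_pos by (intro ln_mult_pos) auto
    ultimately show "a p + a q \<le> a (p + q)" by simp
  next
    fix n :: nat assume n: "1 \<le> n"
    have "D n \<le> real n * D (Suc n)"
      using degree_mean_mult_le[of "n - 1" 0] n by (simp add: D_def)
    hence "D n / real n \<le> D (Suc n)" using n by (simp add: divide_le_eq mult.commute)
    hence "D n / real n / (8 * real (Suc n)) \<le> D (Suc n) / (8 * real (Suc n))"
      by (rule divide_right_mono) simp
    hence "D n / (8 * real n) / (real n + 1) \<le> D (Suc n) / (8 * real (Suc n))"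
      by (simp add: mult_ac add.commute)
    hence "ln (D n / (8 * real n) / (real n + 1)) \<le> a (Suc n)"
      unfolding a_def using n D_pos by (intro ln_mono) auto
    thus "a n - ln (real n + 1) \<le> a (Suc n)"
      unfolding a_def using n D_pos[of n] by (subst (asm) ln_div) auto
  next
    fix n :: nat assume n: "1 \<le> n"
    have "D n \<le> 4 * 16 ^ (n - 1)" unfolding D_def by (rule degree_mean_le)
    also have "\<dots> \<le> 16 ^ n" using n by (cases n) simp_all
    also have "\<dots> \<le> 16 ^ n * (8 * real n)" using n by simp
    finally have "D n / (8 * real n) \<le> 16 ^ n" using n by (simp add: divide_simps mult_ac)
    hence "a n \<le> ln (16 ^ n)" unfolding a_def using n D_pos[of n] by (intro ln_mono) auto
    thus "a n \<le> ln 16 * real n" by (simp add: ln_realpow mult.commute)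
  qed
  then obtain L where L: "(\<lambda>n. a n / real n) \<longlonglongrightarrow> L" by (auto simp: convergent_def)
  have "(\<lambda>n. a (Suc n) / real (Suc n) * (real (Suc n) / real n) + ln (8 * real (Suc n)) / real n)
          \<longlonglongrightarrow> L * 1 + 0"
    by (intro tendsto_add tendsto_mult LIMSEQ_Suc[OF L]) real_asymp+
  moreover have "\<forall>\<^sub>F n in sequentially.
      a (Suc n) / real (Suc n) * (real (Suc n) / real n) + ln (8 * real (Suc n)) / real n
        = ln (degree_mean n) / real n"
  proof (rule eventually_sequentiallyI[of 1])
    fix n :: nat assume n: "1 \<le> n"
    have aS: "a (Suc n) = ln (degree_mean n) - ln (8 * real (Suc n))"
      unfolding a_def D_def using degree_mean_ge_1[of n] by (subst ln_div) auto
    have "a (Suc n) / real (Suc n) * (real (Suc n) / real n) = a (Suc n) / real n"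
      by (simp del: of_nat_Suc)
    thus "a (Suc n) / real (Suc n) * (real (Suc n) / real n) + ln (8 * real (Suc n)) / real n
        = ln (degree_mean n) / real n"
      by (simp only: aS add_divide_distrib[symmetric] diff_add_cancel)
  qed
  ultimately have "(\<lambda>n. ln (degree_mean n) / real n) \<longlonglongrightarrow> L * 1 + 0"
    by (rule Lim_transform_eventually)
  thus ?thesis by (rule convergentI)
qed

section \<open>Blow-up of generating functions with a quadratic recurrence\<close>

text \<open>
  The hypothesis on \<open>c\<close> says \<open>F' \<ge> F\<^sup>2\<close> for its generating function \<open>F\<close>, so that \<open>x + 1 / F x\<close>
  decreases and \<open>F\<close> must blow up before \<open>u + 1 / F u\<close>. A power series does not blow up inside its disc
  of convergence, hence \<open>\<rho> \<le> u + 1 / F u\<close>, and a partial sum bounds \<open>F u\<close> from below.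
\<close>
lemma riccati_radius_bound:
  fixes c :: "nat \<Rightarrow> real"
  assumes nonneg: "\<And>n. 0 \<le> c n"
    and conv: "\<And>n. (\<Sum>k\<le>n. c k * c (n - k)) \<le> real (Suc n) * c (Suc n)"
    and summable: "\<And>x. 0 \<le> x \<Longrightarrow> x < \<rho> \<Longrightarrow> summable (\<lambda>n. c n * x ^ n)"
    and u: "0 \<le> u" "u < \<rho>"
    and pos: "0 < (\<Sum>n<N. c n * u ^ n)"
  shows "(\<Sum>n<N. c n * u ^ n) * (\<rho> - u) \<le> 1"
proof -
  define S where "S = (\<Sum>n<N. c n * u ^ n)"
  define F where "F x = (\<Sum>n. c n * x ^ n)" for x
  define F' where "F' x = (\<Sum>n. diffs c n * x ^ n)" for x
  have S_le: "S \<le> F x" if "u \<le> x" "x < \<rho>" for x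
  proof -
    have "S \<le> (\<Sum>n<N. c n * x ^ n)"
      unfolding S_def using nonneg u that by (intro sum_mono mult_left_mono power_mono) auto
    also have "\<dots> \<le> F x"
      unfolding F_def using nonneg u that
      by (intro sum_le_suminf summable) (auto intro!: mult_nonneg_nonneg)
    finally show ?thesis .
  qed
  have deriv: "(F has_real_derivative F' x) (at x)" and F'_ge: "(F x)\<^sup>2 \<le> F' x"
    if x: "u \<le> x" "x < \<rho>" for x
  proof -
    obtain K where K: "x < K" "K < \<rho>" using dense x by blast
    have sum_K: "summable (\<lambda>n. c n * K ^ n)" using u x K by (intro summable) auto
    have norm: "norm x < norm K" using u x K by auto
    show "(F has_real_derivative F' x) (at x)"
      unfolding F_def[abs_def] F'_def by (rule termdiffs_strong[OF sum_K norm])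
    have "summable (\<lambda>n. norm (c n * x ^ n))"
      using summable[of x] nonneg u x by (simp add: abs_mult)
    from Cauchy_product_sums[OF this this]
    have "(\<lambda>n. \<Sum>k\<le>n. (c k * x ^ k) * (c (n - k) * x ^ (n - k))) sums (F x * F x)"
      unfolding F_def .
    moreover have "(\<Sum>k\<le>n. (c k * x ^ k) * (c (n - k) * x ^ (n - k)))
        = (\<Sum>k\<le>n. c k * c (n - k)) * x ^ n" for n
      unfolding sum_distrib_right
      by (intro sum.cong refl) (simp add: power_add[symmetric] mult_ac)
    ultimately have sq: "(\<lambda>n. (\<Sum>k\<le>n. c k * c (n - k)) * x ^ n) sums (F x * F x)" by simp
    have "summable (\<lambda>n. diffs c n * x ^ n)"
    proof (rule termdiff_converges)
      show "norm x < \<bar>K\<bar>" using norm by simp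
      show "summable (\<lambda>n. c n * z ^ n)" if "norm z < \<bar>K\<bar>" for z
        using powser_inside[OF sum_K, of z] that by simp
    qed
    hence d: "(\<lambda>n. diffs c n * x ^ n) sums F' x"
      unfolding F'_def by (rule summable_sums)
    have le: "(\<Sum>k\<le>n. c k * c (n - k)) * x ^ n \<le> diffs c n * x ^ n" for n
      unfolding diffs_def using conv[of n] u x by (intro mult_right_mono) simp_all
    show "(F x)\<^sup>2 \<le> F' x"
      unfolding power2_eq_square by (rule sums_le[OF le sq d])
  qed
  have "y \<le> u + 1 / S" if y: "u < y" "y < \<rho>" for y
  proof -
    define G where "G x = x + 1 / F x" for x
    have "G y \<le> G u"
    proof (rule DERIV_nonpos_imp_nonincreasing[of u y G])
      show "u \<le> y" using y by simp
      fix x assume x: "u \<le> x" "x \<le> y"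
      hence F: "0 < F x" using S_le[of x] pos y unfolding S_def[symmetric] by simp
      have "(G has_real_derivative (1 - F' x / (F x)\<^sup>2)) (at x)"
        unfolding G_def[abs_def] using F x y
        by (auto intro!: derivative_eq_intros deriv simp: power2_eq_square field_simps)
      moreover have "1 - F' x / (F x)\<^sup>2 \<le> 0"
        using F'_ge[of x] F x y by (simp add: field_simps)
      ultimately show "\<exists>D. (G has_real_derivative D) (at x) \<and> D \<le> 0" by blast
    qed
    moreover have "1 / F u \<le> 1 / S"
      using S_le[of u] pos u unfolding S_def[symmetric] by (intro divide_left_mono) auto
    moreover have "0 \<le> 1 / F y"
      using S_le[of y] pos y unfolding S_def[symmetric] by simp
    ultimately show ?thesis unfolding G_def by linarith
  qed
  hence "\<rho> \<le> u + 1 / S" using u(2) by (rule dense_le_bounded[rotated])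
  thus ?thesis
    using pos unfolding S_def[symmetric] by (simp add: field_simps)
qed

section \<open>Numerical lower bounds from the recurrences\<close>

definition list_conv :: "int list \<Rightarrow> int list \<Rightarrow> int" where
  "list_conv xs ys = sum_list (map2 (*) xs (rev ys))"

text \<open>
  One step of the two recurrences for \<open>degree_mean k * (59 / 100) ^ k\<close> and
  \<open>overlap_mean k * (59 / 100) ^ k\<close>, run on integers: entries are lower bounds in units of
  \<open>1 / 1000\<close>, rounded down. After the scaling by \<open>(59 / 100) ^ k\<close> the sequences vary slowly, so three
  digits lose little. The list \<open>cs\<close> has its head replaced by \<open>0\<close> because the empty word is excluded.
\<close>
definition bound_step :: "int \<Rightarrow> int list \<times> int list \<Rightarrow> int list \<times> int list" where
  "bound_step n = (\<lambda>(bs, es). let cs = 0 # tl bs in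
     (bs @ [59 * (list_conv bs bs + 2000 * last cs + 4000 * last es) div (100000 * n)],
      es @ [59 * (list_conv cs (map2 (\<lambda>b e. 2 * b + e) bs es) + 4000 * last es) div (100000 * n)]))"

text \<open>
  In units of \<open>1 / 1000\<close>, the threshold stands for \<open>42.1\<close>. It exceeds
  \<open>1 / (1 / 1.62924 - 59 / 100)\<close>, which is about \<open>42.05\<close>. The point \<open>59 / 100\<close> lies close below
  \<open>1 / 1.62924\<close>, about \<open>0.6138\<close>, so that few terms suffice.
\<close>
lemma bound_numeric: "42100 \<le> sum_list (fst (fold bound_step [1..62] ([1000], [0])))"
  by code_simp

text \<open>
  The lists stay nonnegative so that products of lower bounds are lower bounds of products.
\<close>
definition list_lower :: "int list \<Rightarrow> (nat \<Rightarrow> real) \<Rightarrow> nat \<Rightarrow> bool" where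
  "list_lower xs g n \<longleftrightarrow> length xs = n \<and> (\<forall>k<n. 0 \<le> xs ! k \<and> real_of_int (xs ! k) \<le> 1000 * g k)"

lemma list_lower_snoc:
  assumes "list_lower xs g n" "0 \<le> v" "real_of_int v \<le> 1000 * g n"
  shows "list_lower (xs @ [v]) g (Suc n)"
  using assms by (auto simp: list_lower_def nth_append less_Suc_eq)

lemma list_lower_last:
  assumes "list_lower xs g (Suc n)"
  shows "0 \<le> last xs" "real_of_int (last xs) \<le> 1000 * g n"
proof -
  have len: "length xs = Suc n" using assms by (simp add: list_lower_def)
  hence "xs \<noteq> []" by auto
  hence "last xs = xs ! n" by (simp add: last_conv_nth len)
  thus "0 \<le> last xs" "real_of_int (last xs) \<le> 1000 * g n"
    using assms by (auto simp: list_lower_def)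
qed

lemma list_lower_zero_head:
  assumes "list_lower xs g (Suc n)"
  shows "list_lower (0 # tl xs) (\<lambda>k. if k = 0 then 0 else g k) (Suc n)"
  using assms by (auto simp: list_lower_def nth_Cons nth_tl split: nat.split)

lemma list_lower_combine:
  assumes "list_lower xs f n" "list_lower ys g n"
  shows "list_lower (map2 (\<lambda>b e. 2 * b + e) xs ys) (\<lambda>k. 2 * f k + g k) n"
  using assms by (auto simp: list_lower_def distrib_left intro: add_mono mult_left_mono)

lemma list_conv_lower:
  assumes xs: "list_lower xs f (Suc n)" and ys: "list_lower ys g (Suc n)"
  shows "0 \<le> list_conv xs ys"
    and "real_of_int (list_conv xs ys) \<le> 1000000 * (\<Sum>k\<le>n. f k * g (n - k))"
proof -
  have len: "length xs = Suc n" "length ys = Suc n" using xs ys by (auto simp: list_lower_def)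
  have eq: "list_conv xs ys = (\<Sum>k\<le>n. xs ! k * ys ! (n - k))"
    unfolding list_conv_def sum_list_sum_nth using len
    by (auto simp: rev_nth atLeast0LessThan lessThan_Suc_atMost intro!: sum.cong)
  have bounds: "0 \<le> xs ! k" "0 \<le> ys ! (n - k)" "real_of_int (xs ! k) \<le> 1000 * f k"
    "real_of_int (ys ! (n - k)) \<le> 1000 * g (n - k)" if "k \<le> n" for k
    using xs ys that by (auto simp: list_lower_def)
  show "0 \<le> list_conv xs ys"
    unfolding eq by (intro sum_nonneg mult_nonneg_nonneg bounds) auto
  have "real_of_int (list_conv xs ys) = (\<Sum>k\<le>n. real_of_int (xs ! k) * real_of_int (ys ! (n - k)))"
    by (simp add: eq)
  also have "\<dots> \<le> (\<Sum>k\<le>n. (1000 * f k) * (1000 * g (n - k)))"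
  proof (intro sum_mono mult_mono)
    fix k assume "k \<in> {..n}"
    hence k: "k \<le> n" by simp
    show "real_of_int (xs ! k) \<le> 1000 * f k" "real_of_int (ys ! (n - k)) \<le> 1000 * g (n - k)"
      "0 \<le> real_of_int (ys ! (n - k))" using bounds[OF k] by simp_all
    show "0 \<le> 1000 * f k" using bounds(1,3)[OF k] by linarith
  qed
  also have "\<dots> = 1000000 * (\<Sum>k\<le>n. f k * g (n - k))"
    unfolding sum_distrib_left by (intro sum.cong refl) simp
  finally show "real_of_int (list_conv xs ys) \<le> 1000000 * (\<Sum>k\<le>n. f k * g (n - k))" .
qed

lemma bound_step_div:
  assumes "0 \<le> a" "real_of_int a \<le> 1000000 * y" "59 / 100 * y \<le> real (Suc n) * z"
  shows "0 \<le> 59 * a div (100000 * int (Suc n))"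
    and "real_of_int (59 * a div (100000 * int (Suc n))) \<le> 1000 * z"
proof -
  let ?d = "100000 * int (Suc n)"
  show "0 \<le> 59 * a div ?d" using assms(1) by (simp add: pos_imp_zdiv_nonneg_iff)
  have "(59 * a div ?d) * ?d \<le> 59 * a"
    by (metis div_mult_mod_eq le_add_same_cancel1 pos_mod_sign of_nat_0_less_iff
        zero_less_Suc zero_less_mult_iff zero_less_numeral)
  hence "real_of_int ((59 * a div ?d) * ?d) \<le> real_of_int (59 * a)" by (simp only: of_int_le_iff)
  hence "real_of_int (59 * a div ?d) * (100000 * real (Suc n)) \<le> 59 * real_of_int a" by simp
  also have "\<dots> \<le> 1000 * z * (100000 * real (Suc n))" using assms(2,3) by (simp add: algebra_simps)
  finally show "real_of_int (59 * a div ?d) \<le> 1000 * z"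
    by (simp add: mult_le_cancel_right_pos)
qed

text \<open>
  The recurrences for the two mean sequences after multiplication of the \<open>k\<close>-th terms by
  \<open>(59 / 100) ^ k\<close>.
\<close>
locale mean_recurrence =
  fixes p q :: "nat \<Rightarrow> real"
  assumes p_0: "p 0 = 1" and q_0: "0 \<le> q 0"
    and p_Suc: "59 / 100 * ((\<Sum>k\<le>n. p k * p (n - k)) + 2 * (if n = 0 then 0 else p n) + 4 * q n)
                  \<le> real (Suc n) * p (Suc n)"
    and q_Suc: "59 / 100 * ((\<Sum>k\<le>n. (if k = 0 then 0 else p k) * (2 * p (n - k) + q (n - k)))
                   + 4 * q n) \<le> real (Suc n) * q (Suc n)"
begin

lemma bound_step_lower:
  assumes "list_lower bs p (Suc n)" "list_lower es q (Suc n)"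
    "bound_step (int (Suc n)) (bs, es) = (bs', es')"
  shows "list_lower bs' p (Suc (Suc n))" "list_lower es' q (Suc (Suc n))"
proof -
  let ?c = "\<lambda>k. if k = 0 then 0 else p k"
  define cs where "cs = 0 # tl bs"
  have cs: "list_lower cs ?c (Suc n)"
    unfolding cs_def by (rule list_lower_zero_head[OF assms(1)])
  let ?a = "list_conv bs bs + 2000 * last cs + 4000 * last es"
  let ?a' = "list_conv cs (map2 (\<lambda>b e. 2 * b + e) bs es) + 4000 * last es"
  have step: "bs' = bs @ [59 * ?a div (100000 * int (Suc n))]"
    "es' = es @ [59 * ?a' div (100000 * int (Suc n))]"
    using assms(3) by (simp_all add: bound_step_def Let_def cs_def)
  note lower = list_lower_last[OF assms(2)] list_lower_last[OF cs]
    list_conv_lower[OF assms(1) assms(1)]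
    list_conv_lower[OF cs list_lower_combine[OF assms(1,2)]]
  have a: "0 \<le> ?a" "real_of_int ?a \<le> 1000000 * ((\<Sum>k\<le>n. p k * p (n - k)) + 2 * ?c n + 4 * q n)"
    using lower by (simp_all add: distrib_left)
  have a': "0 \<le> ?a'" "real_of_int ?a' \<le> 1000000 *
      ((\<Sum>k\<le>n. ?c k * (2 * p (n - k) + q (n - k))) + 4 * q n)"
    using lower by (simp_all add: distrib_left)
  show "list_lower bs' p (Suc (Suc n))"
    unfolding step by (intro list_lower_snoc assms(1) bound_step_div[OF a p_Suc])
  show "list_lower es' q (Suc (Suc n))"
    unfolding step by (intro list_lower_snoc assms(2) bound_step_div[OF a' q_Suc])
qed

lemma fold_bound_step_lower:
  "\<exists>bs es. fold bound_step [1..int n] ([1000], [0]) = (bs, es) \<and>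
     list_lower bs p (Suc n) \<and> list_lower es q (Suc n)"
proof (induction n)
  case 0
  show ?case using p_0 q_0 by (simp add: list_lower_def)
next
  case (Suc n)
  then obtain bs es where IH: "fold bound_step [1..int n] ([1000], [0]) = (bs, es)"
    "list_lower bs p (Suc n)" "list_lower es q (Suc n)" by blast
  obtain bs' es' where step: "bound_step (int (Suc n)) (bs, es) = (bs', es')"
    by (cases "bound_step (int (Suc n)) (bs, es)")
  have "[1..int (Suc n)] = [1..int n] @ [int (Suc n)]"
    using upto_rec2[of 1 "int (Suc n)"] by simp
  hence "fold bound_step [1..int (Suc n)] ([1000], [0]) = (bs', es')"
    by (simp only: fold_append comp_apply IH(1) fold_simps step)
  thus ?case using bound_step_lower[OF IH(2,3) step] by blast
qed

lemma partial_sum_lower: "421 / 10 \<le> (\<Sum>k<63. p k)"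
proof -
  obtain bs es where st: "fold bound_step [1..62] ([1000], [0]) = (bs, es)"
    and bs: "list_lower bs p 63"
    using fold_bound_step_lower[of 62] by auto
  have "42100 \<le> real_of_int (sum_list bs)"
    using bound_numeric unfolding st fst_conv by simp
  also have "\<dots> = (\<Sum>k<63. real_of_int (bs ! k))"
    using bs by (simp add: list_lower_def sum_list_sum_nth atLeast0LessThan)
  also have "\<dots> \<le> (\<Sum>k<63. 1000 * p k)"
    using bs by (intro sum_mono) (auto simp: list_lower_def)
  finally show ?thesis by (simp add: sum_distrib_left[symmetric])
qed

end

lemma degree_mean_partial_sum: "421 / 10 \<le> (\<Sum>k<63. degree_mean k * (59 / 100) ^ k)"
proof -
  let ?x = "59 / 100 :: real"
  have scale: "(\<Sum>k\<le>n. f k * ?x ^ k * (g (n - k) * ?x ^ (n - k))) = (\<Sum>k\<le>n. f k * g (n - k)) * ?x ^ n"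
    for f g :: "nat \<Rightarrow> real" and n
  proof -
    have "f k * ?x ^ k * (g (n - k) * ?x ^ (n - k)) = f k * g (n - k) * ?x ^ n" if "k \<le> n" for k
    proof -
      have "?x ^ n = ?x ^ k * ?x ^ (n - k)" using that by (simp add: power_add[symmetric])
      thus ?thesis by (simp only: mult_ac)
    qed
    thus ?thesis unfolding sum_distrib_right by (intro sum.cong) (auto simp del: mult_cancel_left)
  qed
  let ?c = "\<lambda>k. if k = 0 then 0 else degree_mean k"
  interpret mean_recurrence "\<lambda>k. degree_mean k * ?x ^ k" "\<lambda>k. overlap_mean k * ?x ^ k"
  proof
    fix n
    have "((\<Sum>k\<le>n. degree_mean k * degree_mean (n - k)) + 2 * ?c n + 4 * overlap_mean n) * ?x ^ Suc n
            \<le> (real (Suc n) * degree_mean (Suc n)) * ?x ^ Suc n"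
      by (intro mult_right_mono degree_mean_Suc) simp
    thus "?x * ((\<Sum>k\<le>n. degree_mean k * ?x ^ k * (degree_mean (n - k) * ?x ^ (n - k)))
          + 2 * (if n = 0 then 0 else degree_mean n * ?x ^ n) + 4 * (overlap_mean n * ?x ^ n))
          \<le> real (Suc n) * (degree_mean (Suc n) * ?x ^ Suc n)"
      unfolding scale by (cases "n = 0") (simp_all add: algebra_simps)
    have "((\<Sum>k\<le>n. ?c k * (2 * degree_mean (n - k) + overlap_mean (n - k))) + 4 * overlap_mean n) * ?x ^ Suc n
            \<le> (real (Suc n) * overlap_mean (Suc n)) * ?x ^ Suc n"
      by (intro mult_right_mono overlap_mean_Suc) simp
    moreover have "(\<Sum>k\<le>n. (if k = 0 then 0 else degree_mean k * ?x ^ k) *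
             (2 * (degree_mean (n - k) * ?x ^ (n - k)) + overlap_mean (n - k) * ?x ^ (n - k)))
        = (\<Sum>k\<le>n. ?c k * (2 * degree_mean (n - k) + overlap_mean (n - k))) * ?x ^ n"
      unfolding scale[of ?c "\<lambda>k. 2 * degree_mean k + overlap_mean k", symmetric]
      by (intro sum.cong refl) (simp add: algebra_simps)
    ultimately show "?x * ((\<Sum>k\<le>n. (if k = 0 then 0 else degree_mean k * ?x ^ k) *
             (2 * (degree_mean (n - k) * ?x ^ (n - k)) + overlap_mean (n - k) * ?x ^ (n - k)))
          + 4 * (overlap_mean n * ?x ^ n)) \<le> real (Suc n) * (overlap_mean (Suc n) * ?x ^ Suc n)"
      by (simp only: power_Suc) (simp add: algebra_simps)
  qed (simp_all add: overlap_mean_nonneg)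
  show ?thesis by (rule partial_sum_lower)
qed

section \<open>The lower bound for the growth rate\<close>

text \<open>
  The root test for a growth rate \<open>l \<le> r\<close>.
\<close>
lemma summable_degree_mean:
  assumes lim: "(\<lambda>n. degree_mean n powr (1 / real n)) \<longlonglongrightarrow> l" and "l \<le> r" "0 < r"
    and x: "0 \<le> x" "x < 1 / r"
  shows "summable (\<lambda>n. degree_mean n * x ^ n)"
proof -
  obtain t where t: "r < t" "t * x < 1"
  proof (cases "x = 0")
    case True
    thus ?thesis using that[of "r + 1"] by simp
  next
    case False
    hence "r < 1 / x" using x \<open>0 < r\<close> by (simp add: field_simps)
    then obtain t where "r < t" "t < 1 / x" using dense by blast
    thus ?thesis using that[of t] x False by (simp add: field_simps)
  qed
  have "\<forall>\<^sub>F n in sequentially. degree_mean n powr (1 / real n) < t"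
    using order_tendstoD(2)[OF lim, of t] t(1) \<open>l \<le> r\<close> by simp
  hence "\<forall>\<^sub>F n in sequentially. norm (degree_mean n * x ^ n) \<le> (t * x) ^ n"
    using eventually_ge_at_top[of 1]
  proof eventually_elim
    case (elim n)
    have "degree_mean n = (degree_mean n powr (1 / real n)) ^ n"
      using elim degree_mean_ge_1[of n] by (simp add: powr_realpow[symmetric] powr_powr)
    also have "\<dots> \<le> t ^ n" using elim by (intro power_mono) auto
    finally show ?case
      using x degree_mean_nonneg[of n] by (simp add: power_mult_distrib mult_right_mono)
  qed
  moreover have "summable (\<lambda>n. (t * x) ^ n)"
    using t x \<open>0 < r\<close> by (intro summable_geometric) simp
  ultimately show ?thesis by (rule summable_comparison_test_ev)
qed

theorem theorem7p29:
  "convergent (\<lambda>n::nat. deg_noninv (permutations_of_set {1..n}) stack_sort powr (1 / real n)) \<and>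
   1.62924 < lim (\<lambda>n::nat. deg_noninv (permutations_of_set {1..n}) stack_sort powr (1 / real n))"
proof -
  let ?b = "\<lambda>n. degree_mean n powr (1 / real n)"
  obtain L where "(\<lambda>n. ln (degree_mean n) / real n) \<longlonglongrightarrow> L"
    using convergent_ln_degree_mean by (auto simp: convergent_def)
  hence "(\<lambda>n. exp (ln (degree_mean n) / real n)) \<longlonglongrightarrow> exp L"
    by (rule tendsto_exp)
  moreover have "exp (ln (degree_mean n) / real n) = ?b n" for n
    using degree_mean_ge_1[of n] by (simp add: powr_def)
  ultimately have lim: "?b \<longlonglongrightarrow> exp L" by simp
  \<comment> \<open>If the growth rate were at most \<open>1.62924\<close>, the generating function would converge on
    \<open>[0, 1 / 1.62924)\<close>, but its value at \<open>59 / 100\<close> forces it to blow up earlier.\<close>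
  have "1.62924 < exp L"
  proof (rule ccontr)
    assume "\<not> 1.62924 < exp L"
    hence le: "exp L \<le> 1.62924" by simp
    have "(\<Sum>k<63. degree_mean k * (59 / 100) ^ k) * (1 / 1.62924 - 59 / 100) \<le> 1"
    proof (rule riccati_radius_bound)
      show "summable (\<lambda>n. degree_mean n * x ^ n)" if "0 \<le> x" "x < 1 / 1.62924" for x
        using lim le _ that by (rule summable_degree_mean) simp
      show "0 < (\<Sum>k<63. degree_mean k * (59 / 100) ^ k)"
        using degree_mean_partial_sum by linarith
    qed (simp_all only: degree_mean_nonneg sum_degree_mean_le, simp_all)
    moreover have "421 / 10 * (1 / 1.62924 - 59 / 100)
        \<le> (\<Sum>k<63. degree_mean k * (59 / 100) ^ k) * (1 / 1.62924 - 59 / 100 :: real)"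
      by (rule mult_right_mono[OF degree_mean_partial_sum]) simp
    ultimately have "421 / 10 * (1 / 1.62924 - 59 / 100 :: real) \<le> 1" by linarith
    thus False by simp
  qed
  thus ?thesis
    unfolding deg_noninv_stack_sort using lim by (auto simp: convergent_def limI)
qed

end
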